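(* Let $(M,d,\mu)$ be a quasi-$b$-geodesic metric measure space satisfying $(VD)_{\mathrm{loc}}$, $(VD)_\infty$ and the Poincaré inequality $(P)_h$ at scale $h$. Suppose that a Markov operator $P$ has a kernel $p$ that is $(h,h')$-compatible with respect to $\mu$. Then there exist $\delta>2$ and $C_S>0$ such that for all $r>0$, all $x\in M$ and all $f\in L^2(B)$, where $B=B(x,r)$, $$\|P_Bf\|_{2\delta/(\delta-2)}^2\le\frac{C_Sr^2}{V(x,r)^{2/\delta}}\left(\mathcal{E}^B(f,f)+r^{-2}\|f\|_2^2\right).$$
   Context: Metric measure space: locally compact metric space with a Radon measure $\mu$ of full support; $B(x,r)=\{y:d(x,y)\le r\}$, $V(x,r)=\mu(B(x,r))$. Quasi-$b$-geodesic: there is $C$ with $d_b\le Cd$, where $d_b(x,y)=\inf\sum_i d(x_i,x_{i+1})$ over sequences $x=x_0,\dots,x_m=y$ with $d(x_i,x_{i+1})\le b$. $(VD)_{\mathrm{loc}}$: for each $r>0$ there is $C_r$ with $V(x,2r)\le C_rV(x,r)$ for all $x$. $(VD)_\infty$: there are $r_0,C>0$ with $V(x,2r)\le CV(x,r)$ for all $x$, $r\ge r_0$. $|\nabla f|_h(x)=\left(\frac1{V(x,h)}\int_{B(x,h)}|f(y)-f(x)|^2\mu(dy)\right)^{1/2}$; $(P)_h$: there are $C_1>0$, $C_2\ge1$, $r_0>0$ with $\int_{B(x,r)}|f-f_{B(x,r)}|^2d\mu\le C_1r^2\int_{B(x,C_2r)}|\nabla f|_h^2d\mu$ for all $f\in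 L^\infty_{\mathrm{loc}}$, $x\in M$, $r\ge r_0$ ($f_B$ the $\mu$-average). Kernel: $p=p_1\ge0$ with $\int p_1(x,y)\mu(dy)=1$, $p_1(x,\cdot)\in L^\infty$, $Pf(x)=\int p_1(x,y)f(y)\mu(dy)$, $p_2(x,y)=\int p_1(x,z)p_1(y,z)\mu(dz)$. $(h,h')$-compatible: $p_1(x,y)=p_1(y,x)$ $\mu\times\mu$-a.e.; there are $c_1,C_1>0$, $h'\ge h$, with $\frac{c_1}{V(x,h)}\mathbf{1}_{B(x,h)}(y)\le p_1(x,y)\le\frac{C_1}{V(x,h')}\mathbf{1}_{B(x,h')}(y)$ for all $x$, $\mu$-a.e. $y$; there is $\alpha>0$ with $p_2(x,y)\ge\alpha p_1(x,y)$ for all $x$, $\mu$-a.e. $y$. For a ball $B$, $L^p(B)=L^p(B,\mu|_B)$ with norm $\|\cdot\|_p$; $P_Bf(x)=\int_Bf(y)p_1(x,y)\mu(dy)$ for $x\in B$, $f\in L^2(B)$; $\mathcal{E}^B(f,f)=\langle f,(I-P_B)f\rangle_{L^2(B)}$. *)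

theory Defs
  imports "HOL-Analysis.Analysis"
begin

definition V :: "'a::metric_space measure \<Rightarrow> 'a \<Rightarrow> real \<Rightarrow> real" where
  "V \<mu> x r = measure \<mu> (cball x r)"

definition radon_full_support :: "'a::metric_space measure \<Rightarrow> bool" where
  "radon_full_support \<mu> \<longleftrightarrow>
     sets \<mu> = sets borel \<and>
     (\<forall>K. compact K \<longrightarrow> emeasure \<mu> K < \<infinity>) \<and>
     (\<forall>A\<in>sets borel. emeasure \<mu> A = (INF U\<in>{U. open U \<and> A \<subseteq> U}. emeasure \<mu> U)) \<and>
     (\<forall>U. open U \<longrightarrow> emeasure \<mu> U = (SUP K\<in>{K. compact K \<and> K \<subseteq> U}. emeasure \<mu> K)) \<and>
     (\<forall>x r. r > 0 \<longrightarrow> emeasure \<mu> (ball x r) > 0)"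

text \<open>The chain distance d_b (infimum over b-chains; infimum of the empty set is \<infinity>).\<close>
definition chain_dist :: "real \<Rightarrow> 'a::metric_space \<Rightarrow> 'a \<Rightarrow> ereal" where
  "chain_dist b x y =
     (INF mp\<in>{(m, p). p 0 = x \<and> p m = y \<and> (\<forall>i<m. dist (p i) (p (Suc i)) \<le> b)}.
        ereal (\<Sum>i<fst mp. dist (snd mp i) (snd mp (Suc i))))"

definition quasi_b_geodesic :: "real \<Rightarrow> 'a::metric_space itself \<Rightarrow> bool" where
  "quasi_b_geodesic b _ \<longleftrightarrow> (\<exists>C. \<forall>x y::'a. chain_dist b x y \<le> ereal (C * dist x y))"

definition VD_loc :: "'a::metric_space measure \<Rightarrow> bool" where
  "VD_loc \<mu> \<longleftrightarrow> (\<forall>r>0. \<exists>C. \<forall>x.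
      emeasure \<mu> (cball x (2 * r)) \<le> ennreal C * emeasure \<mu> (cball x r))"

definition VD_inf :: "'a::metric_space measure \<Rightarrow> bool" where
  "VD_inf \<mu> \<longleftrightarrow> (\<exists>r0>0. \<exists>C>0. \<forall>x r. r \<ge> r0 \<longrightarrow>
      emeasure \<mu> (cball x (2 * r)) \<le> ennreal C * emeasure \<mu> (cball x r))"

definition L_inf_loc :: "'a::metric_space measure \<Rightarrow> ('a \<Rightarrow> real) set" where
  "L_inf_loc \<mu> = {f. f \<in> borel_measurable \<mu> \<and>
      (\<forall>K. compact K \<longrightarrow> (\<exists>c. AE y in \<mu>. y \<in> K \<longrightarrow> \<bar>f y\<bar> \<le> c))}"

definition grad_sq :: "'a::metric_space measure \<Rightarrow> real \<Rightarrow> ('a \<Rightarrow> real) \<Rightarrow> 'a \<Rightarrow> ennreal" where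
  "grad_sq \<mu> h f x = (\<integral>\<^sup>+ y\<in>cball x h. ennreal ((f y - f x)\<^sup>2) \<partial>\<mu>) / ennreal (V \<mu> x h)"

definition ball_avg :: "'a::metric_space measure \<Rightarrow> ('a \<Rightarrow> real) \<Rightarrow> 'a set \<Rightarrow> real" where
  "ball_avg \<mu> f B = (\<integral>y\<in>B. f y \<partial>\<mu>) / measure \<mu> B"

definition poincare :: "'a::metric_space measure \<Rightarrow> real \<Rightarrow> bool" where
  "poincare \<mu> h \<longleftrightarrow> (\<exists>C1>0. \<exists>C2\<ge>1. \<exists>r0>0. \<forall>f\<in>L_inf_loc \<mu>. \<forall>x r. r \<ge> r0 \<longrightarrow>
      (\<integral>\<^sup>+ y\<in>cball x r. ennreal ((f y - ball_avg \<mu> f (cball x r))\<^sup>2) \<partial>\<mu>)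
        \<le> ennreal (C1 * r\<^sup>2) * (\<integral>\<^sup>+ y\<in>cball x (C2 * r). grad_sq \<mu> h f y \<partial>\<mu>))"

definition markov_kernel :: "'a::metric_space measure \<Rightarrow> ('a \<Rightarrow> 'a \<Rightarrow> real) \<Rightarrow> bool" where
  "markov_kernel \<mu> p \<longleftrightarrow>
     (\<lambda>(x, y). p x y) \<in> borel_measurable (\<mu> \<Otimes>\<^sub>M \<mu>) \<and>
     (\<forall>x y. p x y \<ge> 0) \<and>
     (\<forall>x. integrable \<mu> (p x) \<and> (\<integral>y. p x y \<partial>\<mu>) = 1) \<and>
     (\<forall>x. \<exists>c. AE y in \<mu>. \<bar>p x y\<bar> \<le> c)"

definition p2 :: "'a::metric_space measure \<Rightarrow> ('a \<Rightarrow> 'a \<Rightarrow> real) \<Rightarrow> 'a \<Rightarrow> 'a \<Rightarrow> real" where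
  "p2 \<mu> p x y = (\<integral>z. p x z * p y z \<partial>\<mu>)"

definition compatible :: "'a::metric_space measure \<Rightarrow> ('a \<Rightarrow> 'a \<Rightarrow> real) \<Rightarrow> real \<Rightarrow> real \<Rightarrow> bool" where
  "compatible \<mu> p h h' \<longleftrightarrow>
     (AE xy in \<mu> \<Otimes>\<^sub>M \<mu>. p (fst xy) (snd xy) = p (snd xy) (fst xy)) \<and>
     h' \<ge> h \<and>
     (\<exists>c1>0. \<exists>C1>0. \<forall>x. AE y in \<mu>.
        c1 / V \<mu> x h * indicator (cball x h) y \<le> p x y \<and>
        p x y \<le> C1 / V \<mu> x h' * indicator (cball x h') y) \<and>
     (\<exists>\<alpha>>0. \<forall>x. AE y in \<mu>. p2 \<mu> p x y \<ge> \<alpha> * p x y)"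

definition L2_on :: "'a::metric_space measure \<Rightarrow> 'a set \<Rightarrow> ('a \<Rightarrow> real) set" where
  "L2_on \<mu> B = {f. f \<in> borel_measurable \<mu> \<and> set_integrable \<mu> B (\<lambda>y. (f y)\<^sup>2)}"

definition P_B :: "'a::metric_space measure \<Rightarrow> ('a \<Rightarrow> 'a \<Rightarrow> real) \<Rightarrow> 'a set \<Rightarrow> ('a \<Rightarrow> real) \<Rightarrow> 'a \<Rightarrow> real" where
  "P_B \<mu> p B f x = (\<integral>y\<in>B. f y * p x y \<partial>\<mu>)"

definition Lp_norm_on :: "'a::metric_space measure \<Rightarrow> 'a set \<Rightarrow> real \<Rightarrow> ('a \<Rightarrow> real) \<Rightarrow> real" where
  "Lp_norm_on \<mu> B q g = (\<integral>y\<in>B. \<bar>g y\<bar> powr q \<partial>\<mu>) powr (1 / q)"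

definition energy_B :: "'a::metric_space measure \<Rightarrow> ('a \<Rightarrow> 'a \<Rightarrow> real) \<Rightarrow> 'a set \<Rightarrow> ('a \<Rightarrow> real) \<Rightarrow> real" where
  "energy_B \<mu> p B f = (\<integral>y\<in>B. f y * (f y - P_B \<mu> p B f y) \<partial>\<mu>)"

end

theory Submission
  imports Defs
begin

text \<open>
  Put \<open>g = f 1\<^sub>B\<close>. Up to constants, \<open>\<bar>\<nabla>g\<bar>\<^sub>h\<^sup>2\<close> is dominated by
  \<open>\<Gamma>(x) = \<integral> p(x,y) (g(y) - g(x))\<^sup>2 dy\<close>, whose total mass is \<open>2 E(g,g)\<close>. Since \<open>P g(x)\<close> is itself
  an average of \<open>g\<close> at scale \<open>h'\<close>, the Poincare inequality bounds the successive differences of the averages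
  of \<open>g\<close> over \<open>B(x, s)\<close>, \<open>s = \<rho> / 4\<^sup>k\<close>, from scale \<open>h'\<close> up to \<open>\<rho> \<approx> r\<close>, by
  \<open>s A\<^sub>k\<^sup>1\<^sup>/\<^sup>2\<close> with \<open>A\<^sub>k(x) = V(x,s)\<^sup>-\<^sup>1 \<integral>\<^bsub>B(x,Ks)\<^esub> \<Gamma>\<close>, and the top average is at most
  \<open>V(x,\<rho>)\<^sup>-\<^sup>1\<^sup>/\<^sup>2 \<parallel>f\<parallel>\<^sub>2\<close>.
  By doubling, the integral of \<open>A\<^sub>k\<close> is at most a constant times \<open>E\<close>, while its supremum is at most
  \<open>D\<^sup>k V(B)\<^sup>-\<^sup>1 E\<close>. Interpolating these two bounds gives a geometric series in \<open>k\<close> as soon as \<open>\<delta>\<close> is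
  strictly larger than the doubling exponent, so neither maximal functions nor heat kernel bounds are needed.
  Radii below the scale of the Poincare inequality are covered by the pointwise bound on \<open>P g\<close>.
\<close>

section \<open>Cauchy-Schwarz against a weight\<close>

text \<open>Comes from the nonnegativity of the integral of \<open>w * (v - t)^2\<close>, a
  quadratic in \<open>t\<close>, taken at its minimum; if the total weight is 0, then
  \<open>w\<close> vanishes almost everywhere. Bounding the second moment in \<open>ennreal\<close>
  makes integrability of \<open>w * v\<close> a conclusion. With \<open>v = g - a\<close> this turns
  L2 oscillation into a difference of averages.\<close>

lemma weighted_cauchy_schwarz:
  fixes w v :: "'a \<Rightarrow> real"
  assumes [measurable]: "v \<in> borel_measurable M" and w: "integrable M w" "\<And>x. 0 \<le> w x"
    and K: "(\<integral>\<^sup>+x. ennreal (w x * (v x)\<^sup>2) \<partial>M) \<le> ennreal K" "0 \<le> K"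
  shows "integrable M (\<lambda>x. w x * v x)" "(\<integral>x. w x * v x \<partial>M)\<^sup>2 \<le> (\<integral>x. w x \<partial>M) * K"
proof -
  have [measurable]: "w \<in> borel_measurable M" using w by auto
  have "(\<integral>\<^sup>+x. ennreal (norm (w x * (v x)\<^sup>2)) \<partial>M) < \<infinity>"
    using K(1) w(2) by (simp add: le_less_trans)
  hence iv2: "integrable M (\<lambda>x. w x * (v x)\<^sup>2)"
    by (intro integrableI_bounded) auto
  have v2: "(\<integral>x. w x * (v x)\<^sup>2 \<partial>M) \<le> K"
    using K by (intro integral_real_bounded)
  show iv: "integrable M (\<lambda>x. w x * v x)"
  proof (rule Bochner_Integration.integrable_bound[OF Bochner_Integration.integrable_add[OF w(1) iv2]])
    have "\<bar>v x\<bar> \<le> 1 + (v x)\<^sup>2" for x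
      using sum_squares_bound[of "\<bar>v x\<bar>" 1] abs_ge_zero[of "v x"]
      unfolding power2_abs power_one by linarith
    hence "w x * \<bar>v x\<bar> \<le> w x * (1 + (v x)\<^sup>2)" for x
      by (intro mult_left_mono w)
    thus "AE x in M. norm (w x * v x) \<le> norm (w x + w x * (v x)\<^sup>2)"
      using w(2) by (auto simp: abs_mult algebra_simps intro!: AE_I2)
  qed auto
  let ?W = "\<integral>x. w x \<partial>M" and ?m = "\<integral>x. w x * v x \<partial>M" and ?S = "\<integral>x. w x * (v x)\<^sup>2 \<partial>M"
  have W0: "0 \<le> ?W" using w by simp
  have quad: "0 \<le> t\<^sup>2 * ?W - 2 * t * ?m + ?S" for t
  proof -
    have "0 \<le> (\<integral>x. w x * (v x - t)\<^sup>2 \<partial>M)"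
      using w by simp
    also have "(\<integral>x. w x * (v x - t)\<^sup>2 \<partial>M) = (\<integral>x. t\<^sup>2 * w x - 2 * t * (w x * v x) + w x * (v x)\<^sup>2 \<partial>M)"
      by (intro Bochner_Integration.integral_cong) (auto simp: power2_eq_square algebra_simps)
    also have "\<dots> = t\<^sup>2 * ?W - 2 * t * ?m + ?S"
      using w iv iv2 by simp
    finally show ?thesis .
  qed
  have "?m\<^sup>2 \<le> ?W * ?S"
  proof (cases "?W = 0")
    case True
    hence "AE x in M. w x = 0"
      using integral_nonneg_eq_0_iff_AE[OF w(1)] w(2) by auto
    hence "?m = (\<integral>x. 0 \<partial>M)" by (intro integral_cong_AE) auto
    thus ?thesis using True by simp
  next
    case False
    hence "?W > 0" using W0 by simp
    thus ?thesis using quad[of "?m / ?W"] by (simp add: power2_eq_square field_simps)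
  qed
  also have "\<dots> \<le> ?W * K" using W0 v2 by (intro mult_left_mono)
  finally show "?m\<^sup>2 \<le> ?W * K" .
qed

section \<open>Uniformly doubling spaces\<close>

text \<open>The constant in \<open>doubling\<close> depends on the threshold \<open>s\<close> and
  may blow up as \<open>s\<close> tends to 0, but it serves all centres and all radii above
  \<open>s\<close>. Local and large-scale doubling together amount to this
  (\<open>doubling_spaceI\<close>).\<close>

locale doubling_space =
  fixes \<mu> :: "'a::metric_space measure"
  assumes sets_mu [measurable_cong]: "sets \<mu> = sets borel"
    and emeasure_cball_finite: "\<And>x r. emeasure \<mu> (cball x r) < \<infinity>"
    and V_pos: "\<And>x r. 0 < r \<Longrightarrow> 0 < V \<mu> x r"
    and doubling: "\<And>s c. 0 < s \<Longrightarrow> \<exists>D\<ge>1. \<forall>x t. t \<ge> s \<longrightarrow> V \<mu> x (c * t) \<le> D * V \<mu> x t"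
begin

lemma space_mu [simp]: "space \<mu> = UNIV"
  using sets_eq_imp_space_eq[OF sets_mu] by simp

lemma emeasure_cball: "emeasure \<mu> (cball x r) = ennreal (V \<mu> x r)"
  using emeasure_cball_finite[of x r] by (simp add: V_def emeasure_eq_ennreal_measure)

lemma cball_sets [measurable]: "cball x r \<in> sets \<mu>" "ball x r \<in> sets \<mu>"
  by (simp_all add: sets_mu)

lemma cball_fmeasurable: "cball x r \<in> fmeasurable \<mu>"
  by (intro fmeasurableI emeasure_cball_finite cball_sets)

lemma V_nonneg [simp]: "0 \<le> V \<mu> x r"
  by (simp add: V_def)

lemma V_mono: "cball x r \<subseteq> cball y t \<Longrightarrow> V \<mu> x r \<le> V \<mu> y t"
  unfolding V_def by (intro measure_mono_fmeasurable cball_fmeasurable cball_sets)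

lemma V_mono_dist: "dist x y + r \<le> t \<Longrightarrow> V \<mu> x r \<le> V \<mu> y t"
proof (intro V_mono subsetI)
  fix z assume "dist x y + r \<le> t" "z \<in> cball x r"
  thus "z \<in> cball y t" using dist_triangle[of y z x] by (simp add: dist_commute)
qed

lemma sigma_finite_mu: "sigma_finite_measure \<mu>"
proof
  fix x0 :: 'a
  have "\<Union>(range (\<lambda>n::nat. cball x0 (real n))) = UNIV"
    by (auto simp: real_arch_simple)
  thus "\<exists>A. countable A \<and> A \<subseteq> sets \<mu> \<and> \<Union> A = space \<mu> \<and> (\<forall>a\<in>A. emeasure \<mu> a \<noteq> \<infinity>)"
    using emeasure_cball_finite[of x0]
    by (intro exI[of _ "range (\<lambda>n::nat. cball x0 (real n))"]) (auto simp: less_top)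
qed

sublocale sigma_finite_measure \<mu> by (rule sigma_finite_mu)
sublocale pair_sigma_finite \<mu> \<mu> ..

section \<open>Finite nets and separability from doubling\<close>

text \<open>
  Without separability \<open>{(x, y). d(x, y) \<le> s}\<close> need not lie in the product sigma-algebra, and Tonelli would not
  apply to integrals over moving balls. Uniform doubling supplies it.
\<close>

lemma card_separated_le:
  fixes x0 :: "'a"
  assumes "0 < \<epsilon>"
  shows "\<exists>N. \<forall>A. finite A \<longrightarrow> A \<subseteq> cball x0 R \<longrightarrow> (\<forall>a\<in>A. \<forall>b\<in>A. a \<noteq> b \<longrightarrow> dist a b > \<epsilon>) \<longrightarrow> card A \<le> N"
proof -
  \<comment> \<open>The factor takes the radius \<open>\<epsilon> / 2\<close> to
    \<open>2 * \<bar>R\<bar> + \<epsilon>\<close>, large enough for a ball about any point of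
    \<open>cball x0 R\<close> to contain
    \<open>cball x0 (\<bar>R\<bar> + \<epsilon> / 2)\<close>.\<close>
  obtain D where D: "D \<ge> 1" "\<And>x t. t \<ge> \<epsilon> / 2 \<Longrightarrow> V \<mu> x ((2 * \<bar>R\<bar> + \<epsilon>) / (\<epsilon> / 2) * t) \<le> D * V \<mu> x t"
    using doubling[of "\<epsilon> / 2" "(2 * \<bar>R\<bar> + \<epsilon>) / (\<epsilon> / 2)"] assms by auto
  have scale: "(2 * \<bar>R\<bar> + \<epsilon>) / (\<epsilon> / 2) * (\<epsilon> / 2) = 2 * \<bar>R\<bar> + \<epsilon>"
    using assms by (intro nonzero_divide_mult_cancel_right nonzero_eq_divide_eq[THEN iffD1]) auto
  have "card A \<le> nat \<lceil>D\<rceil>" if A: "finite A" "A \<subseteq> cball x0 R" "\<forall>a\<in>A. \<forall>b\<in>A. a \<noteq> b \<longrightarrow> dist a b > \<epsilon>" for A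
  proof -
    let ?v = "V \<mu> x0 (\<bar>R\<bar> + \<epsilon> / 2)"
    have v: "?v > 0" using assms by (intro V_pos) auto
    have lower: "?v / D \<le> V \<mu> a (\<epsilon> / 2)" if "a \<in> A" for a
    proof -
      have "?v \<le> V \<mu> a (2 * \<bar>R\<bar> + \<epsilon>)"
        using that A(2) assms by (intro V_mono_dist) auto
      also have "\<dots> \<le> D * V \<mu> a (\<epsilon> / 2)"
        using D(2)[of "\<epsilon> / 2" a, unfolded scale] by simp
      finally show ?thesis using D(1) by (simp add: field_simps)
    qed
    have disj: "disjoint_family_on (\<lambda>a. cball a (\<epsilon> / 2)) A"
    proof (unfold disjoint_family_on_def, intro ballI impI)
      fix a b assume ab: "a \<in> A" "b \<in> A" "a \<noteq> b"
      hence "dist a b > \<epsilon>" using A(3) by blast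
      moreover have "dist a b \<le> dist a z + dist b z" for z by (rule dist_triangle2)
      ultimately show "cball a (\<epsilon> / 2) \<inter> cball b (\<epsilon> / 2) = {}"
        by (auto simp: disjoint_iff not_le dist_commute) (smt (verit) field_sum_of_halves)
    qed
    \<comment> \<open>Packing: the disjoint balls of radius \<open>\<epsilon> / 2\<close> lie in one
      ball of measure \<open>?v\<close>, and each has measure at least
      \<open>?v / D\<close>.\<close>
    have "real (card A) * (?v / D) \<le> (\<Sum>a\<in>A. V \<mu> a (\<epsilon> / 2))"
      using sum_mono[of A "\<lambda>_. ?v / D" "\<lambda>a. V \<mu> a (\<epsilon> / 2)"] lower by simp
    also have "\<dots> = measure \<mu> (\<Union>a\<in>A. cball a (\<epsilon> / 2))"
      unfolding V_def using A disj emeasure_cball_finite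
      by (intro measure_finite_Union[symmetric]) (auto simp: less_top)
    also have "\<dots> \<le> ?v"
      unfolding V_def
    proof (intro measure_mono_fmeasurable cball_fmeasurable)
      show "(\<Union>a\<in>A. cball a (\<epsilon> / 2)) \<subseteq> cball x0 (\<bar>R\<bar> + \<epsilon> / 2)"
      proof safe
        fix a z assume "a \<in> A" "z \<in> cball a (\<epsilon> / 2)"
        thus "z \<in> cball x0 (\<bar>R\<bar> + \<epsilon> / 2)"
          using A(2) dist_triangle[of x0 z a] by auto
      qed
    qed (use A in auto)
    finally have "real (card A) \<le> D" using v D(1) by (simp add: field_simps)
    thus ?thesis by linarith
  qed
  thus ?thesis by blast
qed

text \<open>A separated subset of the largest possible cardinality is a net, since a point farther
  than \<open>\<epsilon>\<close> from all its members could be added to it.\<close>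

lemma finite_net:
  fixes x0 :: "'a"
  assumes "0 < \<epsilon>"
  shows "\<exists>A. finite A \<and> (\<forall>x\<in>cball x0 R. \<exists>a\<in>A. dist x a \<le> \<epsilon>)"
proof -
  define S where "S A \<longleftrightarrow> finite A \<and> A \<subseteq> cball x0 R \<and> (\<forall>a\<in>A. \<forall>b\<in>A. a \<noteq> b \<longrightarrow> dist a b > \<epsilon>)" for A
  have "\<exists>N. \<forall>A. S A \<longrightarrow> card A \<le> N"
    using card_separated_le[OF assms, of x0 R] unfolding S_def imp_conjL .
  then obtain N where N: "\<forall>A. S A \<longrightarrow> card A < Suc N"
    by (auto simp: less_Suc_eq_le)
  have "S {}" by (simp add: S_def)
  then obtain A where A: "S A" "\<And>A'. S A' \<Longrightarrow> card A' \<le> card A"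
    using ex_has_greatest_nat[OF _ N, of "{}"] by blast
  have "\<exists>a\<in>A. dist x a \<le> \<epsilon>" if "x \<in> cball x0 R" for x
  proof (rule ccontr)
    assume *: "\<not> ?thesis"
    hence far: "\<And>a. a \<in> A \<Longrightarrow> dist x a > \<epsilon>" by (simp add: not_le)
    hence "x \<notin> A" using assms by force
    have "S (insert x A)"
      using A(1) that far by (simp add: S_def dist_commute)
    thus False using A(2)[of "insert x A"] A(1) \<open>x \<notin> A\<close> by (simp add: S_def)
  qed
  moreover have "finite A" using A(1) by (simp add: S_def)
  ultimately show ?thesis by blast
qed

lemma countable_dense:
  "\<exists>D :: 'a set. countable D \<and> (\<forall>(x::'a) \<epsilon>. \<epsilon> > 0 \<longrightarrow> (\<exists>z\<in>D. dist x z < \<epsilon>))"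
proof -
  fix x0 :: 'a
  have "\<forall>i j. \<exists>A. finite A \<and> (\<forall>x\<in>cball x0 (real i). \<exists>a\<in>A. dist x a \<le> 1 / real (Suc j))"
    by (intro allI finite_net) simp
  then obtain net where net: "\<And>i j. finite (net i j)"
    "\<And>i j x. x \<in> cball x0 (real i) \<Longrightarrow> \<exists>a\<in>net i j. dist x a \<le> 1 / real (Suc j)"
    by metis
  have "\<exists>z\<in>(\<Union>i j. net i j). dist x z < \<epsilon>" if eps: "\<epsilon> > 0" for x :: 'a and \<epsilon> :: real
  proof -
    obtain i where "dist x0 x \<le> real i" using real_arch_simple by blast
    moreover obtain j where "1 / real (Suc j) < \<epsilon>"
      using nat_approx_posE[OF eps] by blast
    moreover obtain a where "a \<in> net i j" "dist x a \<le> 1 / real (Suc j)"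
      using net(2)[of x i j] calculation(1) by auto
    ultimately show ?thesis by (intro bexI[of _ a]) auto
  qed
  thus ?thesis using net(1)
    by (intro exI[of _ "\<Union>i j. net i j"]) (use net(1) in \<open>auto intro!: countable_UN intro: countable_finite\<close>)
qed

section \<open>Measurability and averages over moving balls\<close>

text \<open>The band is a countable intersection of countable unions of rectangles centred in a
  dense set. At level \<open>n\<close> a rectangle permits an error of at most
  \<open>2 / Suc n\<close> in the distance, which disappears in the intersection.\<close>

lemma dist_le_sets [measurable]: "{z :: 'a \<times> 'a. dist (fst z) (snd z) \<le> s} \<in> sets (\<mu> \<Otimes>\<^sub>M \<mu>)"
proof -
  obtain D :: "'a set" where D: "countable D" "\<And>(x::'a) \<epsilon>. \<epsilon> > 0 \<Longrightarrow> \<exists>z\<in>D. dist x z < \<epsilon>"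
    using countable_dense by blast
  have "{z :: 'a \<times> 'a. dist (fst z) (snd z) \<le> s} =
      (\<Inter>n::nat. \<Union>a\<in>D. ball a (1 / Suc n) \<times> cball a (s + 1 / Suc n))" (is "?L = ?R")
  proof (intro set_eqI iffI)
    fix z assume "z \<in> ?L"
    thus "z \<in> ?R"
    proof (cases z, clarsimp)
      fix x y :: 'a and n :: nat assume xy: "dist x y \<le> s"
      obtain a where "a \<in> D" "dist x a < 1 / (1 + real n)"
        using D(2)[of "1 / (1 + real n)" x] by auto
      thus "\<exists>a\<in>D. dist a x < 1 / (1 + real n) \<and> dist a y \<le> s + 1 / (1 + real n)"
        using xy dist_triangle[of a y x] by (intro bexI[of _ a]) (auto simp: dist_commute)
    qed
  next
    fix z assume z: "z \<in> ?R"
    obtain x y where [simp]: "z = (x, y)" by (cases z)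
    have "dist x y \<le> s + e" if e: "e > 0" for e
    proof -
      obtain n where n: "1 / real (Suc n) < e / 2"
        using nat_approx_posE[of "e / 2"] e by auto
      obtain a where "dist a x < 1 / Suc n" "dist a y \<le> s + 1 / Suc n"
        using z by auto
      thus ?thesis using n dist_triangle[of x y a] by (simp add: dist_commute)
    qed
    thus "z \<in> ?L" using field_le_epsilon by auto
  qed
  moreover have "?R \<in> sets (\<mu> \<Otimes>\<^sub>M \<mu>)"
    using D(1) by (intro sets.countable_INT sets.countable_UN' image_subsetI pair_measureI) auto
  ultimately show ?thesis by simp
qed

text \<open>The ball \<open>cball x s\<close> is the section at \<open>x\<close> of the measurable
  band.\<close>

lemma V_measurable [measurable]: "(\<lambda>x. V \<mu> x s) \<in> borel_measurable \<mu>"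
proof -
  have "(\<lambda>x. enn2real (emeasure \<mu> (Pair x -` {z :: 'a \<times> 'a. dist (fst z) (snd z) \<le> s}))) \<in> borel_measurable \<mu>"
    by measurable
  moreover have "Pair x -` {z :: 'a \<times> 'a. dist (fst z) (snd z) \<le> s} = cball x s" for x :: 'a
    by auto
  ultimately show ?thesis by (simp add: V_def measure_def)
qed

lemma nn_integral_cball_measurable [measurable]:
  assumes [measurable]: "H \<in> borel_measurable \<mu>"
  shows "(\<lambda>x. \<integral>\<^sup>+y\<in>cball x s. (H y :: ennreal) \<partial>\<mu>) \<in> borel_measurable \<mu>"
proof -
  have "(\<lambda>x. \<integral>\<^sup>+y. H y * indicator {z :: 'a \<times> 'a. dist (fst z) (snd z) \<le> s} (x, y) \<partial>\<mu>) \<in> borel_measurable \<mu>"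
    by measurable
  thus ?thesis by (simp add: indicator_def)
qed

text \<open>By Tonelli, \<open>H y\<close> is counted with the integral of
  \<open>1 / V \<mu> x s\<close> over \<open>x\<close> in \<open>cball y (K * s)\<close>. For such
  \<open>x\<close> this ball lies in \<open>cball x (2 * K * s)\<close>, so doubling by the factor
  \<open>2 * K\<close> bounds the integral by \<open>D\<close>. The constant is the same for all
  scales \<open>s \<ge> s0\<close>, which permits its use at every step of the telescoping.\<close>

lemma nn_integral_averages_le:
  assumes "0 < s0" "1 \<le> K"
  shows "\<exists>D\<ge>1. \<forall>H\<in>borel_measurable \<mu>. \<forall>s\<ge>s0.
    (\<integral>\<^sup>+x. ennreal (1 / V \<mu> x s) * (\<integral>\<^sup>+y\<in>cball x (K * s). H y \<partial>\<mu>) \<partial>\<mu>) \<le> ennreal D * (\<integral>\<^sup>+x. H x \<partial>\<mu>)"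
proof -
  obtain D where D: "D \<ge> 1" "\<And>x t. t \<ge> s0 \<Longrightarrow> V \<mu> x (2 * K * t) \<le> D * V \<mu> x t"
    using doubling[of s0 "2 * K"] assms by auto
  have "(\<integral>\<^sup>+x. ennreal (1 / V \<mu> x s) * (\<integral>\<^sup>+y\<in>cball x (K * s). H y \<partial>\<mu>) \<partial>\<mu>) \<le> ennreal D * (\<integral>\<^sup>+x. H x \<partial>\<mu>)"
    if [measurable]: "H \<in> borel_measurable \<mu>" and s: "s \<ge> s0" for H s
  proof -
    let ?\<Delta> = "{z :: 'a \<times> 'a. dist (fst z) (snd z) \<le> K * s}"
    have s0: "s > 0" "K * s > 0" using s assms by auto
    have "(\<integral>\<^sup>+x. ennreal (1 / V \<mu> x s) * (\<integral>\<^sup>+y\<in>cball x (K * s). H y \<partial>\<mu>) \<partial>\<mu>)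
      = (\<integral>\<^sup>+x. \<integral>\<^sup>+y. ennreal (1 / V \<mu> x s) * (H y * indicator ?\<Delta> (x, y)) \<partial>\<mu> \<partial>\<mu>)"
    proof (intro nn_integral_cong)
      fix x
      have "(\<integral>\<^sup>+y\<in>cball x (K * s). H y \<partial>\<mu>) = (\<integral>\<^sup>+y. H y * indicator ?\<Delta> (x, y) \<partial>\<mu>)"
        by (intro nn_integral_cong) (auto simp: indicator_def)
      thus "ennreal (1 / V \<mu> x s) * (\<integral>\<^sup>+y\<in>cball x (K * s). H y \<partial>\<mu>) =
          (\<integral>\<^sup>+y. ennreal (1 / V \<mu> x s) * (H y * indicator ?\<Delta> (x, y)) \<partial>\<mu>)"
        by (simp add: nn_integral_cmult)
    qed
    also have "\<dots> = (\<integral>\<^sup>+y. \<integral>\<^sup>+x. ennreal (1 / V \<mu> x s) * (H y * indicator ?\<Delta> (x, y)) \<partial>\<mu> \<partial>\<mu>)"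
      by (rule Fubini'[symmetric]) measurable
    also have "\<dots> \<le> (\<integral>\<^sup>+y. ennreal D * H y \<partial>\<mu>)"
    proof (intro nn_integral_mono)
      fix y
      have v: "V \<mu> y (K * s) > 0" using s0 by (intro V_pos)
      have "ennreal (1 / V \<mu> x s) * (H y * indicator ?\<Delta> (x, y)) \<le>
          (ennreal (D / V \<mu> y (K * s)) * H y) * indicator (cball y (K * s)) x" for x
      proof (cases "dist x y \<le> K * s")
        case True
        have "V \<mu> y (K * s) \<le> V \<mu> x (2 * K * s)"
          using True by (intro V_mono_dist) (simp add: dist_commute)
        also have "\<dots> \<le> D * V \<mu> x s" using D(2) s by blast
        finally have "1 / V \<mu> x s \<le> D / V \<mu> y (K * s)"
          using v V_pos[OF s0(1), of x] D(1) by (simp add: field_simps)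
        thus ?thesis using True
          by (auto simp: dist_commute intro!: mult_right_mono ennreal_leI)
      qed (auto simp: dist_commute)
      hence "(\<integral>\<^sup>+x. ennreal (1 / V \<mu> x s) * (H y * indicator ?\<Delta> (x, y)) \<partial>\<mu>)
          \<le> (\<integral>\<^sup>+x. (ennreal (D / V \<mu> y (K * s)) * H y) * indicator (cball y (K * s)) x \<partial>\<mu>)"
        by (intro nn_integral_mono)
      also have "\<dots> = ennreal (D / V \<mu> y (K * s)) * H y * ennreal (V \<mu> y (K * s))"
        by (subst nn_integral_cmult_indicator) (auto simp: emeasure_cball)
      also have "\<dots> = ennreal (D / V \<mu> y (K * s) * V \<mu> y (K * s)) * H y"
        using D(1) v by (subst ennreal_mult) (auto simp: mult_ac)
      also have "\<dots> = ennreal D * H y" using v by simp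
      finally show "(\<integral>\<^sup>+x. ennreal (1 / V \<mu> x s) * (H y * indicator ?\<Delta> (x, y)) \<partial>\<mu>) \<le> ennreal D * H y" .
    qed
    also have "\<dots> = ennreal D * (\<integral>\<^sup>+x. H x \<partial>\<mu>)"
      by (rule nn_integral_cmult) measurable
    finally show ?thesis .
  qed
  thus ?thesis using D(1) by blast
qed

end

section \<open>Uniform doubling from the local and the large-scale condition\<close>

text \<open>Closed balls need not be compact, so finiteness starts from a small ball inside a
  compact neighbourhood and spreads to its dilates by local doubling. For the doubling constant,
  large-scale doubling handles radii above its threshold and finitely many local steps handle the
  bounded range below.\<close>

lemma doubling_spaceI:
  fixes \<mu> :: "'a::metric_space measure"
  assumes lc: "locally_compact_space (euclidean :: 'a topology)"
    and radon: "radon_full_support \<mu>" and loc: "VD_loc \<mu>" and inf: "VD_inf \<mu>"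
  shows "doubling_space \<mu>"
proof -
  have sets_mu: "sets \<mu> = sets borel" using radon by (simp add: radon_full_support_def)
  have cball_sets: "cball x r \<in> sets \<mu>" "ball x r \<in> sets \<mu>" for x :: 'a and r
    by (simp_all add: sets_mu)
  have finite: "emeasure \<mu> (cball x r) < \<infinity>" for x r
  proof -
    obtain U K where UK: "open U" "compact K" "x \<in> U" "U \<subseteq> K"
      using lc by (simp add: locally_compact_space_def) blast
    then obtain e where e: "e > 0" "cball x e \<subseteq> U"
      using open_contains_cball by blast
    have "emeasure \<mu> (cball x (2 ^ n * e)) < \<infinity>" for n :: nat
    proof (induction n)
      case 0
      have "emeasure \<mu> (cball x e) \<le> emeasure \<mu> K"
        using e UK by (intro emeasure_mono) (auto simp: sets_mu compact_imp_closed)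
      also have "\<dots> < \<infinity>" using radon UK by (auto simp only: radon_full_support_def)
      finally show ?case by simp
    next
      case (Suc n)
      obtain C where "emeasure \<mu> (cball x (2 * (2 ^ n * e))) \<le> ennreal C * emeasure \<mu> (cball x (2 ^ n * e))"
        using loc e unfolding VD_loc_def by (metis mult_pos_pos zero_less_numeral zero_less_power)
      also have "\<dots> < \<infinity>" using Suc by (simp add: ennreal_mult_less_top)
      finally show ?case by (simp add: mult_ac)
    qed
    moreover obtain n where "r / e < 2 ^ n" using real_arch_pow[of 2 "r / e"] by auto
    moreover have "emeasure \<mu> (cball x r) \<le> emeasure \<mu> (cball x (2 ^ n * e))" if "r / e < 2 ^ n" for n
      using that e cball_sets by (intro emeasure_mono) (auto simp: field_simps)
    ultimately show ?thesis using le_less_trans by blast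
  qed
  have em: "emeasure \<mu> (cball x r) = ennreal (V \<mu> x r)" for x r
    using finite[of x r] by (simp add: V_def emeasure_eq_ennreal_measure)
  have V0: "0 \<le> V \<mu> x r" for x r by (simp add: V_def)
  \<comment> \<open>\<open>ennreal C\<close> reads a negative \<open>C\<close> as 0;
    \<open>max C 1\<close> is valid in either case and is at least 1.\<close>
  have real_bound: "V \<mu> x a \<le> max C 1 * V \<mu> x b"
    if "emeasure \<mu> (cball x a) \<le> ennreal C * emeasure \<mu> (cball x b)" for x a b C
  proof -
    have "ennreal (V \<mu> x a) \<le> ennreal (max C 1) * ennreal (V \<mu> x b)"
      using that unfolding em by (rule order_trans) (intro mult_right_mono ennreal_leI, auto)
    thus ?thesis using V0[of x b] by (simp add: ennreal_mult[symmetric])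
  qed
  have pos: "0 < V \<mu> x r" if "0 < r" for x r
  proof -
    have "0 < emeasure \<mu> (ball x r)" using radon that by (auto simp only: radon_full_support_def)
    also have "\<dots> \<le> emeasure \<mu> (cball x r)" using cball_sets by (intro emeasure_mono) auto
    finally show ?thesis by (simp add: em)
  qed
  have mono: "V \<mu> x a \<le> V \<mu> x b" if "a \<le> b" for x a b
  proof -
    have "emeasure \<mu> (cball x a) \<le> emeasure \<mu> (cball x b)"
      using that cball_sets by (intro emeasure_mono) auto
    thus ?thesis using V0 by (simp add: em)
  qed
  have loc': "\<exists>C\<ge>1. \<forall>x. V \<mu> x (2 ^ n * s) \<le> C * V \<mu> x s" if "s > 0" for s and n :: nat
  proof (induction n)
    case (Suc n)
    then obtain C where C: "C \<ge> 1" "\<And>x. V \<mu> x (2 ^ n * s) \<le> C * V \<mu> x s" by blast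
    have "2 ^ n * s > 0" using that by simp
    then obtain C' where C': "\<And>x. emeasure \<mu> (cball x (2 * (2 ^ n * s))) \<le> ennreal C' * emeasure \<mu> (cball x (2 ^ n * s))"
      using loc unfolding VD_loc_def by blast
    have "V \<mu> x (2 ^ Suc n * s) \<le> max C' 1 * C * V \<mu> x s" for x
    proof -
      have "V \<mu> x (2 ^ Suc n * s) \<le> max C' 1 * V \<mu> x (2 ^ n * s)"
        using real_bound[OF C'[of x]] by (simp add: mult_ac)
      also have "\<dots> \<le> max C' 1 * (C * V \<mu> x s)"
        using C(2) by (intro mult_left_mono) auto
      finally show ?thesis by (simp add: mult_ac)
    qed
    moreover have "max C' 1 * C \<ge> 1" using C(1) mult_mono[of 1 "max C' 1" 1 C] by simp
    ultimately show ?case by blast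
  qed (auto intro: exI[of _ 1])
  have double: "\<exists>D\<ge>1. \<forall>x t. t \<ge> s \<longrightarrow> V \<mu> x (2 * t) \<le> D * V \<mu> x t" if s: "s > 0" for s
  proof -
    obtain r1 C where r1: "r1 > 0"
      "\<And>x r. r \<ge> r1 \<Longrightarrow> emeasure \<mu> (cball x (2 * r)) \<le> ennreal C * emeasure \<mu> (cball x r)"
      using inf unfolding VD_inf_def by blast
    \<comment> \<open>For \<open>s \<le> t < r1\<close> the ball of radius \<open>2 * t\<close> then
      fits into the one of radius \<open>2 ^ n * s\<close>, so a single comparison between two fixed
      radii covers the whole range.\<close>
    obtain n where n: "2 * r1 / s < 2 ^ n" using real_arch_pow[of 2 "2 * r1 / s"] by auto
    obtain C' where C': "C' \<ge> 1" "\<And>x. V \<mu> x (2 ^ n * s) \<le> C' * V \<mu> x s"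
      using loc'[OF s] by blast
    have "V \<mu> x (2 * t) \<le> max (max C 1) C' * V \<mu> x t" if t: "t \<ge> s" for x t
    proof (cases "t \<ge> r1")
      case True
      have "V \<mu> x (2 * t) \<le> max C 1 * V \<mu> x t" by (intro real_bound r1 True)
      also have "\<dots> \<le> max (max C 1) C' * V \<mu> x t" using V0 by (intro mult_right_mono) auto
      finally show ?thesis .
    next
      case False
      have "V \<mu> x (2 * t) \<le> V \<mu> x (2 ^ n * s)"
        using False n s by (intro mono) (simp add: field_simps)
      also have "\<dots> \<le> C' * V \<mu> x s" by (rule C')
      also have "\<dots> \<le> max (max C 1) C' * V \<mu> x t"
        using V0 C'(1) t by (intro mult_mono mono) auto
      finally show ?thesis .
    qed
    thus ?thesis using C'(1) by (intro exI[of _ "max (max C 1) C'"]) auto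
  qed
  have doubling: "\<exists>D\<ge>1. \<forall>x t. t \<ge> s \<longrightarrow> V \<mu> x (c * t) \<le> D * V \<mu> x t" if s: "s > 0" for s c
  proof -
    obtain D where D: "D \<ge> 1" "\<And>x t. t \<ge> s \<Longrightarrow> V \<mu> x (2 * t) \<le> D * V \<mu> x t"
      using double[OF s] by blast
    have it: "V \<mu> x (2 ^ n * t) \<le> D ^ n * V \<mu> x t" if t: "t \<ge> s" for x t and n :: nat
    proof (induction n)
      case (Suc n)
      have "1 * s \<le> 2 ^ n * t" using t s by (intro mult_mono) auto
      hence "V \<mu> x (2 * (2 ^ n * t)) \<le> D * V \<mu> x (2 ^ n * t)" by (intro D) simp
      also have "\<dots> \<le> D * (D ^ n * V \<mu> x t)" using Suc D(1) by (intro mult_left_mono) auto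
      finally show ?case by (simp add: mult_ac)
    qed auto
    obtain n where n: "c < 2 ^ n" using real_arch_pow[of 2 c] by auto
    have "V \<mu> x (c * t) \<le> D ^ n * V \<mu> x t" if t: "t \<ge> s" for x t
      using n t s by (intro order_trans[OF mono it] mult_right_mono) auto
    moreover have "D ^ n \<ge> 1" using D(1) by simp
    ultimately show ?thesis by blast
  qed
  show ?thesis
    by unfold_locales (use sets_mu finite pos doubling in auto)
qed

section \<open>The Dirichlet form of a compatible kernel\<close>

locale markov_doubling_space = doubling_space \<mu> for \<mu> :: "'a::metric_space measure" +
  fixes p :: "'a \<Rightarrow> 'a \<Rightarrow> real" and h h' c C :: real
  assumes p_measurable [measurable]: "(\<lambda>z. p (fst z) (snd z)) \<in> borel_measurable (\<mu> \<Otimes>\<^sub>M \<mu>)"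
    and p_nonneg: "\<And>x y. 0 \<le> p x y"
    and p_integrable: "\<And>x. integrable \<mu> (p x)" and p_integral: "\<And>x. (\<integral>y. p x y \<partial>\<mu>) = 1"
    and p_symmetric: "AE z in \<mu> \<Otimes>\<^sub>M \<mu>. p (fst z) (snd z) = p (snd z) (fst z)"
    and h: "0 < h" "h \<le> h'" and c_pos: "0 < c" and C_pos: "0 < C"
    and p_lower: "\<And>x. AE y in \<mu>. c / V \<mu> x h * indicator (cball x h) y \<le> p x y"
    and p_upper: "\<And>x. AE y in \<mu>. p x y \<le> C / V \<mu> x h' * indicator (cball x h') y"
begin

lemma h'_pos: "0 < h'" using h by simp

lemma p_measurable_snd [measurable]: "p x \<in> borel_measurable \<mu>"
  using p_integrable[of x] by auto

lemma p_nn_integral: "(\<integral>\<^sup>+y. ennreal (p x y) \<partial>\<mu>) = 1"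
  using nn_integral_eq_integral[OF p_integrable[of x]] p_nonneg p_integral[of x] by simp

definition P :: "('a \<Rightarrow> real) \<Rightarrow> 'a \<Rightarrow> real" where
  "P g x = (\<integral>y. p x y * g y \<partial>\<mu>)"

text \<open>Twice the carre du champ of \<open>P\<close>. Values in \<open>ennreal\<close> spare any
  integrability condition at single points.\<close>

definition \<Gamma> :: "('a \<Rightarrow> real) \<Rightarrow> 'a \<Rightarrow> ennreal" where
  "\<Gamma> g x = (\<integral>\<^sup>+y. ennreal (p x y * (g y - g x)\<^sup>2) \<partial>\<mu>)"

definition energy :: "('a \<Rightarrow> real) \<Rightarrow> real" where
  "energy g = (\<integral>x. g x * (g x - P g x) \<partial>\<mu>)"

lemma \<Gamma>_measurable [measurable]:
  assumes [measurable]: "g \<in> borel_measurable \<mu>"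
  shows "\<Gamma> g \<in> borel_measurable \<mu>"
proof -
  have "(\<lambda>x. \<integral>\<^sup>+y. ennreal (p (fst (x, y)) (snd (x, y)) * (g y - g x)\<^sup>2) \<partial>\<mu>) \<in> borel_measurable \<mu>"
    by measurable
  thus ?thesis by (simp add: \<Gamma>_def[abs_def])
qed

text \<open>Expanding the square gives \<open>?a + ?b - 2 * ?c\<close> on the product space. Unit
  mass of the kernel, together with symmetry for \<open>?b\<close>, gives each square term the
  integral of \<open>g^2\<close>; the cross term is dominated by \<open>?a + ?b\<close>, so Fubini
  applies and yields the integral of \<open>g * P g\<close>.\<close>

lemma nn_integral_\<Gamma>:
  assumes [measurable]: "g \<in> borel_measurable \<mu>" and g2: "integrable \<mu> (\<lambda>x. (g x)\<^sup>2)"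
  shows "(\<integral>\<^sup>+x. \<Gamma> g x \<partial>\<mu>) = ennreal (2 * energy g)" "0 \<le> energy g"
proof -
  let ?N = "\<mu> \<Otimes>\<^sub>M \<mu>" and ?p = "\<lambda>z. p (fst z) (snd z)"
  let ?a = "\<lambda>z. ?p z * (g (fst z))\<^sup>2" and ?b = "\<lambda>z. ?p z * (g (snd z))\<^sup>2"
    and ?c = "\<lambda>z. g (fst z) * (?p z * g (snd z))" and ?d = "\<lambda>z. ?p z * (g (snd z) - g (fst z))\<^sup>2"
  have p_swap [measurable]: "(\<lambda>z. p (snd z) (fst z)) \<in> borel_measurable ?N"
    using measurable_compose[OF measurable_pair_swap' p_measurable] by (simp add: case_prod_beta)
  have section_x: "(\<integral>\<^sup>+y. ennreal (p x y * t) \<partial>\<mu>) = ennreal t" if "t \<ge> 0" for x t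
  proof -
    have "(\<integral>\<^sup>+y. ennreal (p x y * t) \<partial>\<mu>) = (\<integral>\<^sup>+y. ennreal (p x y) * ennreal t \<partial>\<mu>)"
      using that p_nonneg by (simp add: ennreal_mult)
    also have "\<dots> = ennreal t" by (subst nn_integral_multc) (simp_all add: p_nn_integral)
    finally show ?thesis .
  qed
  have a: "(\<integral>\<^sup>+z. ennreal (?a z) \<partial>?N) = ennreal (\<integral>x. (g x)\<^sup>2 \<partial>\<mu>)"
  proof -
    have "(\<integral>\<^sup>+z. ennreal (?a z) \<partial>?N) = (\<integral>\<^sup>+x. \<integral>\<^sup>+y. ennreal (?a (x, y)) \<partial>\<mu> \<partial>\<mu>)"
      by (subst sigma_finite_measure.nn_integral_fst[OF sigma_finite_mu, symmetric]) simp_all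
    also have "\<dots> = (\<integral>\<^sup>+x. ennreal ((g x)\<^sup>2) \<partial>\<mu>)" by (simp add: section_x)
    also have "\<dots> = ennreal (\<integral>x. (g x)\<^sup>2 \<partial>\<mu>)" using g2 by (intro nn_integral_eq_integral) auto
    finally show ?thesis .
  qed
  \<comment> \<open>Symmetry is known only almost everywhere for the product measure, so it is
    applied under the double integral. After the swap, the inner integral runs over the second
    argument of the kernel, where the mass is 1.\<close>
  have b: "(\<integral>\<^sup>+z. ennreal (?b z) \<partial>?N) = ennreal (\<integral>x. (g x)\<^sup>2 \<partial>\<mu>)"
  proof -
    have "(\<integral>\<^sup>+z. ennreal (?b z) \<partial>?N) = (\<integral>\<^sup>+z. ennreal (p (snd z) (fst z) * (g (snd z))\<^sup>2) \<partial>?N)"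
      using p_symmetric by (intro nn_integral_cong_AE) auto
    also have "\<dots> = (\<integral>\<^sup>+y. \<integral>\<^sup>+x. ennreal (p y x * (g y)\<^sup>2) \<partial>\<mu> \<partial>\<mu>)"
      by (subst nn_integral_snd[symmetric]) simp_all
    also have "\<dots> = (\<integral>\<^sup>+x. ennreal ((g x)\<^sup>2) \<partial>\<mu>)" by (simp add: section_x)
    also have "\<dots> = ennreal (\<integral>x. (g x)\<^sup>2 \<partial>\<mu>)" using g2 by (intro nn_integral_eq_integral) auto
    finally show ?thesis .
  qed
  have ia: "integrable ?N ?a" and ib: "integrable ?N ?b"
    using a b p_nonneg by (auto intro!: integrableI_bounded simp: abs_mult)
  have "integrable ?N (\<lambda>z. ?a z + ?b z)" using ia ib by simp
  hence ic: "integrable ?N ?c"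
  proof (rule Bochner_Integration.integrable_bound)
    have "\<bar>u * v\<bar> \<le> u\<^sup>2 + v\<^sup>2" for u v :: real
      using sum_squares_bound[of "\<bar>u\<bar>" "\<bar>v\<bar>"] mult_nonneg_nonneg[OF abs_ge_zero[of u] abs_ge_zero[of v]]
      unfolding abs_mult power2_abs by linarith
    hence "?p z * \<bar>g (fst z) * g (snd z)\<bar> \<le> ?p z * ((g (fst z))\<^sup>2 + (g (snd z))\<^sup>2)" for z
      by (intro mult_left_mono p_nonneg)
    thus "AE z in ?N. norm (?c z) \<le> norm (?a z + ?b z)"
      using p_nonneg by (auto simp: abs_mult algebra_simps)
  qed measurable
  have d: "?d z = ?a z + ?b z - 2 * ?c z" for z by (simp add: power2_eq_square algebra_simps)
  have id: "integrable ?N ?d" unfolding d using ia ib ic by simp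
  have int_a: "(\<integral>z. ?a z \<partial>?N) = (\<integral>x. (g x)\<^sup>2 \<partial>\<mu>)" and int_b: "(\<integral>z. ?b z \<partial>?N) = (\<integral>x. (g x)\<^sup>2 \<partial>\<mu>)"
    using a b p_nonneg by (auto simp: integral_eq_nn_integral)
  have ic': "integrable \<mu> (\<lambda>x. g x * P g x)"
    using integrable_fst'[OF ic] by (simp add: P_def)
  have int_c: "(\<integral>z. ?c z \<partial>?N) = (\<integral>x. g x * P g x \<partial>\<mu>)"
    using integral_fst'[OF ic] by (simp add: P_def)
  have "energy g = (\<integral>x. (g x)\<^sup>2 - g x * P g x \<partial>\<mu>)"
    by (simp add: energy_def power2_eq_square algebra_simps)
  also have "\<dots> = (\<integral>x. (g x)\<^sup>2 \<partial>\<mu>) - (\<integral>x. g x * P g x \<partial>\<mu>)"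
    using g2 ic' by simp
  finally have e: "(\<integral>z. ?d z \<partial>?N) = 2 * energy g"
    unfolding d using ia ib ic by (simp add: int_a int_b int_c)
  have "(\<integral>\<^sup>+x. \<Gamma> g x \<partial>\<mu>) = (\<integral>\<^sup>+z. ennreal (?d z) \<partial>?N)"
    unfolding \<Gamma>_def by (subst sigma_finite_measure.nn_integral_fst[OF sigma_finite_mu, symmetric]) simp_all
  also have "\<dots> = ennreal (\<integral>z. ?d z \<partial>?N)"
    using id p_nonneg by (intro nn_integral_eq_integral) auto
  finally show "(\<integral>\<^sup>+x. \<Gamma> g x \<partial>\<mu>) = ennreal (2 * energy g)" unfolding e .
  have "0 \<le> (\<integral>z. ?d z \<partial>?N)" using p_nonneg by simp
  thus "0 \<le> energy g" unfolding e by simp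
qed

text \<open>On \<open>cball x h\<close> the uniform density \<open>1 / V \<mu> x h\<close> is at
  most \<open>p x y / c\<close>.\<close>

lemma grad_sq_le:
  assumes [measurable]: "g \<in> borel_measurable \<mu>"
  shows "grad_sq \<mu> h g x \<le> ennreal (1 / c) * \<Gamma> g x"
proof -
  have v: "V \<mu> x h > 0" using h by (intro V_pos)
  have "grad_sq \<mu> h g x = (\<integral>\<^sup>+y. ennreal ((g y - g x)\<^sup>2) * indicator (cball x h) y / ennreal (V \<mu> x h) \<partial>\<mu>)"
    unfolding grad_sq_def by (rule nn_integral_divide[symmetric]) measurable
  also have "\<dots> \<le> (\<integral>\<^sup>+y. ennreal (1 / c) * ennreal (p x y * (g y - g x)\<^sup>2) \<partial>\<mu>)"
    using p_lower[of x]
  proof (intro nn_integral_mono_AE, eventually_elim)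
    fix y assume *: "c / V \<mu> x h * indicator (cball x h) y \<le> p x y"
    show "ennreal ((g y - g x)\<^sup>2) * indicator (cball x h) y / ennreal (V \<mu> x h) \<le>
        ennreal (1 / c) * ennreal (p x y * (g y - g x)\<^sup>2)"
    proof (cases "y \<in> cball x h")
      case True
      hence "1 / V \<mu> x h \<le> p x y / c" using * c_pos v by (simp add: field_simps)
      hence "(g y - g x)\<^sup>2 / V \<mu> x h \<le> 1 / c * (p x y * (g y - g x)\<^sup>2)"
        using mult_right_mono[of "1 / V \<mu> x h" "p x y / c" "(g y - g x)\<^sup>2"] by simp
      thus ?thesis using True v c_pos p_nonneg
        by (simp add: divide_ennreal ennreal_mult[symmetric] ennreal_leI del: ennreal_mult'')
    qed simp
  qed
  also have "\<dots> = ennreal (1 / c) * \<Gamma> g x"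
    unfolding \<Gamma>_def by (rule nn_integral_cmult) measurable
  finally show ?thesis .
qed

text \<open>The inequality is given for locally bounded functions, and \<open>g\<close> is only
  square integrable. Truncation at height \<open>n\<close> is a contraction, so it does not increase
  \<open>\<Gamma>\<close>; Fatou's lemma then passes the bound to the limit. On the way the gradient
  is replaced by \<open>\<Gamma>\<close>.\<close>

lemma poincare_L2:
  assumes PI: "\<And>f x r. f \<in> L_inf_loc \<mu> \<Longrightarrow> r \<ge> r0 \<Longrightarrow>
      (\<integral>\<^sup>+ y\<in>cball x r. ennreal ((f y - ball_avg \<mu> f (cball x r))\<^sup>2) \<partial>\<mu>)
        \<le> ennreal (C1 * r\<^sup>2) * (\<integral>\<^sup>+ y\<in>cball x (C2 * r). grad_sq \<mu> h f y \<partial>\<mu>)"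
    and "0 < C1" and r: "r \<ge> r0"
    and g [measurable]: "g \<in> borel_measurable \<mu>" and g2: "integrable \<mu> (\<lambda>x. (g x)\<^sup>2)"
  shows "(\<integral>\<^sup>+ y\<in>cball x r. ennreal ((g y - ball_avg \<mu> g (cball x r))\<^sup>2) \<partial>\<mu>)
        \<le> ennreal (C1 / c * r\<^sup>2) * (\<integral>\<^sup>+ y\<in>cball x (C2 * r). \<Gamma> g y \<partial>\<mu>)"
proof -
  let ?B = "cball x r"
  define f where "f n y = max (- real n) (min (real n) (g y))" for n :: nat and y
  have f_meas [measurable]: "f n \<in> borel_measurable \<mu>" for n unfolding f_def by measurable
  have f_Linf: "f n \<in> L_inf_loc \<mu>" for n
  proof -
    have "\<bar>f n y\<bar> \<le> real n" for y by (auto simp: f_def)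
    thus ?thesis by (auto simp: L_inf_loc_def)
  qed
  have f_lim: "(\<lambda>n. f n y) \<longlonglongrightarrow> g y" for y
  proof (rule tendsto_eventually)
    obtain N where N: "\<bar>g y\<bar> \<le> real N" using real_arch_simple by blast
    show "\<forall>\<^sub>F n in sequentially. f n y = g y"
      using eventually_ge_at_top[of N] by eventually_elim (use N in \<open>auto simp: f_def\<close>)
  qed
  have contraction: "(f n y - f n z)\<^sup>2 \<le> (g y - g z)\<^sup>2" for n y z
    by (intro abs_le_square_iff[THEN iffD1]) (auto simp: f_def)
  have \<Gamma>_f: "\<Gamma> (f n) y \<le> \<Gamma> g y" for n y
    unfolding \<Gamma>_def by (intro nn_integral_mono ennreal_leI mult_left_mono contraction p_nonneg)
  define R where "R = ennreal (C1 / c * r\<^sup>2) * (\<integral>\<^sup>+ y\<in>cball x (C2 * r). \<Gamma> g y \<partial>\<mu>)"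
  have bound: "(\<integral>\<^sup>+ y\<in>?B. ennreal ((f n y - ball_avg \<mu> (f n) ?B)\<^sup>2) \<partial>\<mu>) \<le> R" for n
  proof -
    have "(\<integral>\<^sup>+ y\<in>cball x (C2 * r). grad_sq \<mu> h (f n) y \<partial>\<mu>)
      \<le> (\<integral>\<^sup>+ y. ennreal (1 / c) * (\<Gamma> g y * indicator (cball x (C2 * r)) y) \<partial>\<mu>)"
    proof (intro nn_integral_mono)
      fix y
      have "grad_sq \<mu> h (f n) y \<le> ennreal (1 / c) * \<Gamma> g y"
        using grad_sq_le[OF f_meas] \<Gamma>_f by (meson mult_left_mono order_trans zero_le)
      thus "grad_sq \<mu> h (f n) y * indicator (cball x (C2 * r)) y
          \<le> ennreal (1 / c) * (\<Gamma> g y * indicator (cball x (C2 * r)) y)"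
        by (auto simp: indicator_def)
    qed
    also have "\<dots> = ennreal (1 / c) * (\<integral>\<^sup>+ y\<in>cball x (C2 * r). \<Gamma> g y \<partial>\<mu>)"
      by (rule nn_integral_cmult) measurable
    finally have "ennreal (C1 * r\<^sup>2) * (\<integral>\<^sup>+ y\<in>cball x (C2 * r). grad_sq \<mu> h (f n) y \<partial>\<mu>)
      \<le> ennreal (C1 * r\<^sup>2) * (ennreal (1 / c) * (\<integral>\<^sup>+ y\<in>cball x (C2 * r). \<Gamma> g y \<partial>\<mu>))"
      by (intro mult_left_mono) auto
    also have "\<dots> = R"
      using \<open>0 < C1\<close> c_pos by (simp add: R_def mult.assoc[symmetric] ennreal_mult[symmetric] del: ennreal_mult'')
    finally show ?thesis using PI[OF f_Linf r] order_trans by blast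
  qed
  \<comment> \<open>On the ball \<open>g\<close> is integrable, by Cauchy-Schwarz with the indicator
    as weight, and its absolute value dominates all truncations.\<close>
  have avg_lim: "(\<lambda>n. ball_avg \<mu> (f n) ?B) \<longlonglongrightarrow> ball_avg \<mu> g ?B"
  proof -
    have g_int: "integrable \<mu> (\<lambda>y. indicator ?B y * g y)"
    proof (rule weighted_cauchy_schwarz(1)[where K = "\<integral>y. (g y)\<^sup>2 \<partial>\<mu>"])
      show "integrable \<mu> (indicator ?B :: 'a \<Rightarrow> real)"
        using emeasure_cball_finite by (intro integrable_real_indicator) auto
      have "(\<integral>\<^sup>+y. ennreal (indicator ?B y * (g y)\<^sup>2) \<partial>\<mu>) \<le> (\<integral>\<^sup>+y. ennreal ((g y)\<^sup>2) \<partial>\<mu>)"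
        by (intro nn_integral_mono ennreal_leI) (auto simp: indicator_def)
      also have "\<dots> = ennreal (\<integral>y. (g y)\<^sup>2 \<partial>\<mu>)"
        using g2 by (intro nn_integral_eq_integral) auto
      finally show "(\<integral>\<^sup>+y. ennreal (indicator ?B y * (g y)\<^sup>2) \<partial>\<mu>) \<le> \<dots>" .
    qed auto
    have "(\<lambda>n. \<integral>y. indicator ?B y * f n y \<partial>\<mu>) \<longlonglongrightarrow> (\<integral>y. indicator ?B y * g y \<partial>\<mu>)"
    proof (rule integral_dominated_convergence)
      show "integrable \<mu> (\<lambda>y. \<bar>indicator ?B y * g y\<bar>)" using g_int by (rule integrable_abs)
      show "AE y in \<mu>. (\<lambda>n. indicator ?B y * f n y) \<longlonglongrightarrow> indicator ?B y * g y"
        by (intro AE_I2 tendsto_intros f_lim)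
      show "AE y in \<mu>. norm (indicator ?B y * f n y) \<le> \<bar>indicator ?B y * g y\<bar>" for n
        by (intro AE_I2) (auto simp: f_def indicator_def)
    qed measurable
    thus ?thesis unfolding ball_avg_def set_lebesgue_integral_def
      by (auto intro!: tendsto_intros simp: measure_nonneg divide_inverse)
  qed
  let ?F = "\<lambda>n y. ennreal ((f n y - ball_avg \<mu> (f n) ?B)\<^sup>2) * indicator ?B y"
  have lim: "liminf (\<lambda>n. ?F n y) = ennreal ((g y - ball_avg \<mu> g ?B)\<^sup>2) * indicator ?B y" for y
  proof (cases "y \<in> ?B")
    case True
    have "(\<lambda>n. ennreal ((f n y - ball_avg \<mu> (f n) ?B)\<^sup>2)) \<longlonglongrightarrow> ennreal ((g y - ball_avg \<mu> g ?B)\<^sup>2)"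
      by (intro tendsto_ennrealI tendsto_intros f_lim avg_lim)
    hence "liminf (\<lambda>n. ennreal ((f n y - ball_avg \<mu> (f n) ?B)\<^sup>2)) = ennreal ((g y - ball_avg \<mu> g ?B)\<^sup>2)"
      by (rule lim_imp_Liminf[OF trivial_limit_sequentially])
    thus ?thesis using True by simp
  qed (simp add: Liminf_const)
  have "(\<integral>\<^sup>+ y\<in>?B. ennreal ((g y - ball_avg \<mu> g ?B)\<^sup>2) \<partial>\<mu>) = (\<integral>\<^sup>+ y. liminf (\<lambda>n. ?F n y) \<partial>\<mu>)"
    unfolding lim ..
  also have "\<dots> \<le> liminf (\<lambda>n. \<integral>\<^sup>+ y. ?F n y \<partial>\<mu>)"
    by (rule nn_integral_liminf) measurable
  also have "\<dots> \<le> liminf (\<lambda>n :: nat. R)"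
    using bound by (intro Liminf_mono) auto
  also have "\<dots> = R" by (simp add: Liminf_const)
  finally show ?thesis unfolding R_def .
qed

end

section \<open>Interpolation and telescoping over scales\<close>

text \<open>Trades a sum for twice one of its terms, so that a power of the sum is controlled by a
  power of a single term.\<close>

lemma geometric_sum_le_max:
  fixes u :: "nat \<Rightarrow> real"
  assumes "\<And>k. 0 \<le> u k"
  shows "\<exists>k\<le>n. (\<Sum>i\<le>n. (1 / 2) ^ i * u i) \<le> 2 * u k"
proof -
  obtain k where k: "k \<le> n" "\<And>i. i \<le> n \<Longrightarrow> u i \<le> u k"
    using obtains_MAX[of "{..n}" u] by (metis Max_ge atMost_iff empty_iff finite_atMost finite_imageI imageI le0)
  have "(\<Sum>i\<le>n. (1 / 2) ^ i * u i) \<le> (\<Sum>i\<le>n. (1 / 2) ^ i * u k)"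
    using k by (intro sum_mono mult_left_mono) auto
  also have "\<dots> = (\<Sum>i\<le>n. (1 / 2) ^ i) * u k" by (simp add: sum_distrib_right)
  also have "\<dots> \<le> 2 * u k"
  proof (intro mult_right_mono assms)
    have "(\<Sum>i\<le>n. (1 / 2 :: real) ^ i) = 2 - (1 / 2) ^ n"
      by (induction n) auto
    thus "(\<Sum>i\<le>n. (1 / 2 :: real) ^ i) \<le> 2" by simp
  qed
  finally show ?thesis using k(1) by blast
qed

text \<open>Interpolation: \<open>T k x powr \<kappa>\<close> is \<open>T k x\<close> times its
  \<open>m\<close>-th root. The root is estimated by the supremum bound and costs
  \<open>2 ^ k\<close>, since \<open>D \<le> 2 ^ m\<close>; the remaining factor is integrated and
  gains \<open>4 ^ k\<close>. What is left is summable in \<open>k\<close>, uniformly in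
  \<open>n\<close>.\<close>

lemma nn_integral_powr_le:
  fixes T :: "nat \<Rightarrow> 'a \<Rightarrow> real" and F :: "'a \<Rightarrow> real" and m n :: nat
  defines "\<kappa> \<equiv> 1 + 1 / real m"
  assumes [measurable]: "B \<in> sets M" "\<And>k. T k \<in> borel_measurable M"
    and B: "emeasure M B = ennreal v" "0 \<le> v"
    and m: "0 < m" "0 \<le> D" "D \<le> 2 ^ m"
    and nonneg: "0 \<le> A" "0 \<le> Y" "0 \<le> L" "\<And>k x. 0 \<le> T k x" "\<And>x. 0 \<le> F x"
    and T_sup: "\<And>k x. k \<le> n \<Longrightarrow> x \<in> B \<Longrightarrow> T k x \<le> A * D ^ k / 4 ^ k * Y"
    and T_int: "\<And>k. k \<le> n \<Longrightarrow> (\<integral>\<^sup>+x\<in>B. ennreal (T k x) \<partial>M) \<le> ennreal (A / 4 ^ k * v * Y)"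
    and F: "\<And>x. x \<in> B \<Longrightarrow> \<exists>k\<le>n. F x \<le> L * (T k x + A * Y)"
  shows "(\<integral>\<^sup>+x\<in>B. ennreal (F x powr \<kappa>) \<partial>M) \<le> ennreal (3 * v * (2 * L * A * Y) powr \<kappa>)"
proof -
  have \<kappa>: "\<kappa> > 0" using m by (simp add: \<kappa>_def add_pos_nonneg)
  have split: "t powr \<kappa> = t * t powr (1 / real m)" if "t \<ge> 0" for t
    using that by (simp add: \<kappa>_def powr_add)
  have T_powr: "T k x powr \<kappa> \<le> T k x * ((A * Y) powr (1 / real m) * 2 ^ k)" if "k \<le> n" "x \<in> B" for k x
  proof -
    \<comment> \<open>The factor \<open>4 ^ k\<close> of the supremum bound can be given up, because
      the integral bound brings its own.\<close>
    have "D ^ k / 4 ^ k \<le> (2 ^ m) ^ k"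
    proof -
      have "D ^ k / 4 ^ k \<le> D ^ k / 1" using m by (intro divide_left_mono) auto
      also have "\<dots> \<le> (2 ^ m) ^ k" using m by (simp add: power_mono)
      finally show ?thesis .
    qed
    hence "T k x \<le> A * Y * (2 ^ k) ^ m"
      using T_sup[OF that] nonneg mult_left_mono[of "D ^ k / 4 ^ k" "(2 ^ m) ^ k" "A * Y"]
      by (simp add: mult_ac power_mult[symmetric])
    hence "T k x powr (1 / real m) \<le> (A * Y * (2 ^ k) ^ m) powr (1 / real m)"
      using nonneg by (intro powr_mono2) auto
    also have "\<dots> = (A * Y) powr (1 / real m) * 2 ^ k"
      using nonneg m by (simp add: powr_mult powr_realpow[symmetric] powr_powr)
    finally show ?thesis unfolding split[OF nonneg(4)]
      using nonneg by (intro mult_left_mono) auto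
  qed
  have T_powr_int: "(\<integral>\<^sup>+x\<in>B. ennreal (T k x powr \<kappa>) \<partial>M) \<le> ennreal (v * (A * Y) powr \<kappa> * (1 / 2) ^ k)"
    if k: "k \<le> n" for k
  proof -
    let ?c = "(A * Y) powr (1 / real m) * 2 ^ k"
    have "(\<integral>\<^sup>+x\<in>B. ennreal (T k x powr \<kappa>) \<partial>M) \<le> (\<integral>\<^sup>+x. ennreal ?c * (ennreal (T k x) * indicator B x) \<partial>M)"
      using T_powr[OF k] nonneg
      by (intro nn_integral_mono) (auto simp: indicator_def ennreal_mult[symmetric] mult_ac intro!: ennreal_leI)
    also have "\<dots> = ennreal ?c * (\<integral>\<^sup>+x\<in>B. ennreal (T k x) \<partial>M)"
      by (rule nn_integral_cmult) measurable
    also have "\<dots> \<le> ennreal ?c * ennreal (A / 4 ^ k * v * Y)"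
      by (intro mult_left_mono T_int k) auto
    also have "\<dots> = ennreal (?c * (A / 4 ^ k * v * Y))"
      using nonneg B by (intro ennreal_mult[symmetric]) auto
    also have "?c * (A / 4 ^ k * v * Y) = v * (A * Y) powr \<kappa> * (1 / 2) ^ k"
    proof -
      have "(2 :: real) ^ k / 4 ^ k = (1 / 2) ^ k" by (simp add: power_divide[symmetric])
      moreover have "?c * (A / 4 ^ k * v * Y) = v * (A * Y * (A * Y) powr (1 / real m)) * (2 ^ k / 4 ^ k)"
        by simp
      ultimately show ?thesis using split[of "A * Y"] nonneg by simp
    qed
    finally show ?thesis .
  qed
  have F_powr: "F x powr \<kappa> \<le> (2 * L) powr \<kappa> * ((\<Sum>k\<le>n. T k x powr \<kappa>) + (A * Y) powr \<kappa>)" if x: "x \<in> B" for x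
  proof -
    obtain k where k: "k \<le> n" "F x \<le> L * (T k x + A * Y)" using F[OF x] by blast
    \<comment> \<open>The index \<open>k\<close> varies with \<open>x\<close>. Bounding the power of
      the maximum by the sum over all indices removes this dependence.\<close>
    have "T k x + A * Y \<le> 2 * max (T k x) (A * Y)" by linarith
    hence "L * (T k x + A * Y) \<le> 2 * L * max (T k x) (A * Y)"
      using nonneg(3) mult_left_mono by fastforce
    hence "F x powr \<kappa> \<le> (2 * L * max (T k x) (A * Y)) powr \<kappa>"
      using k(2) nonneg \<kappa> by (intro powr_mono2) auto
    also have "\<dots> = (2 * L) powr \<kappa> * max (T k x) (A * Y) powr \<kappa>"
      by (rule powr_mult)
    also have "\<dots> \<le> (2 * L) powr \<kappa> * ((\<Sum>k\<le>n. T k x powr \<kappa>) + (A * Y) powr \<kappa>)"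
    proof (intro mult_left_mono)
      have "T k x powr \<kappa> \<le> (\<Sum>k\<le>n. T k x powr \<kappa>)"
        using k(1) by (intro member_le_sum) auto
      moreover have "max (T k x) (A * Y) powr \<kappa> \<le> T k x powr \<kappa> + (A * Y) powr \<kappa>"
        by (auto simp: max_def)
      ultimately show "max (T k x) (A * Y) powr \<kappa> \<le> (\<Sum>k\<le>n. T k x powr \<kappa>) + (A * Y) powr \<kappa>" by linarith
    qed simp
    finally show ?thesis .
  qed
  have T_powr_meas: "(\<lambda>x. ennreal (T k x powr \<kappa>) * indicator B x) \<in> borel_measurable M" for k
    by measurable
  have const_meas: "(\<lambda>x. ennreal ((A * Y) powr \<kappa>) * indicator B x) \<in> borel_measurable M"
    by measurable
  have "(\<integral>\<^sup>+x\<in>B. ennreal (F x powr \<kappa>) \<partial>M) \<le>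
      (\<integral>\<^sup>+x. ennreal ((2 * L) powr \<kappa>) * ((\<Sum>k\<le>n. ennreal (T k x powr \<kappa>) * indicator B x)
        + ennreal ((A * Y) powr \<kappa>) * indicator B x) \<partial>M)"
  proof (intro nn_integral_mono)
    fix x
    show "ennreal (F x powr \<kappa>) * indicator B x \<le> ennreal ((2 * L) powr \<kappa>) *
      ((\<Sum>k\<le>n. ennreal (T k x powr \<kappa>) * indicator B x) + ennreal ((A * Y) powr \<kappa>) * indicator B x)"
    proof (cases "x \<in> B")
      case True
      have "ennreal (F x powr \<kappa>) \<le> ennreal ((2 * L) powr \<kappa> * ((\<Sum>k\<le>n. T k x powr \<kappa>) + (A * Y) powr \<kappa>))"
        by (intro ennreal_leI F_powr True)
      also have "\<dots> = ennreal ((2 * L) powr \<kappa>) * ((\<Sum>k\<le>n. ennreal (T k x powr \<kappa>)) + ennreal ((A * Y) powr \<kappa>))"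
        by (simp add: ennreal_mult ennreal_plus sum_nonneg sum_ennreal)
      finally show ?thesis using True by simp
    qed simp
  qed
  also have "\<dots> = ennreal ((2 * L) powr \<kappa>) * ((\<Sum>k\<le>n. \<integral>\<^sup>+x\<in>B. ennreal (T k x powr \<kappa>) \<partial>M)
        + ennreal ((A * Y) powr \<kappa>) * emeasure M B)"
    by (simp only: nn_integral_cmult nn_integral_add nn_integral_sum nn_integral_cmult_indicator
      borel_measurable_sum borel_measurable_add T_powr_meas const_meas assms(2))
  also have "\<dots> \<le> ennreal ((2 * L) powr \<kappa>) * ((\<Sum>k\<le>n. ennreal (v * (A * Y) powr \<kappa> * (1 / 2) ^ k))
        + ennreal ((A * Y) powr \<kappa>) * emeasure M B)"
    using T_powr_int by (intro mult_left_mono add_right_mono sum_mono) auto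
  also have "\<dots> = ennreal ((2 * L) powr \<kappa> * ((\<Sum>k\<le>n. v * (A * Y) powr \<kappa> * (1 / 2) ^ k) + (A * Y) powr \<kappa> * v))"
    using B by (subst sum_ennreal) (simp_all add: ennreal_mult[symmetric] ennreal_plus[symmetric] sum_nonneg
      del: ennreal_mult'' ennreal_plus)
  also have "\<dots> \<le> ennreal (3 * v * (2 * L * A * Y) powr \<kappa>)"
  proof (intro ennreal_leI)
    \<comment> \<open>The series contributes 2 and the constant term 1, hence the factor 3.\<close>
    have "(\<Sum>k\<le>n. v * (A * Y) powr \<kappa> * (1 / 2) ^ k) \<le> 2 * (v * (A * Y) powr \<kappa>)"
      using geometric_sum_le_max[of "\<lambda>_. v * (A * Y) powr \<kappa>" n] B by (auto simp: mult_ac)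
    hence "(2 * L) powr \<kappa> * ((\<Sum>k\<le>n. v * (A * Y) powr \<kappa> * (1 / 2) ^ k) + (A * Y) powr \<kappa> * v)
        \<le> (2 * L) powr \<kappa> * (3 * v * (A * Y) powr \<kappa>)"
      by (intro mult_left_mono) auto
    also have "\<dots> = 3 * v * (2 * L * A * Y) powr \<kappa>"
      using powr_mult[of "2 * L" "A * Y" \<kappa>] nonneg by (simp add: mult_ac)
    finally show "(2 * L) powr \<kappa> * ((\<Sum>k\<le>n. v * (A * Y) powr \<kappa> * (1 / 2) ^ k) + (A * Y) powr \<kappa> * v)
        \<le> 3 * v * (2 * L * A * Y) powr \<kappa>" .
  qed
  finally show ?thesis .
qed

section \<open>Comparison of averages at successive scales\<close>

locale poincare_markov_space = markov_doubling_space \<mu> p h h' c C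
  for \<mu> :: "'a::metric_space measure" and p h h' c C +
  fixes r0 C1 C2 :: real
  assumes r0: "0 < r0" and C1: "0 < C1" and C2: "1 \<le> C2"
    and poincare: "\<And>f x r. f \<in> L_inf_loc \<mu> \<Longrightarrow> r \<ge> r0 \<Longrightarrow>
      (\<integral>\<^sup>+ y\<in>cball x r. ennreal ((f y - ball_avg \<mu> f (cball x r))\<^sup>2) \<partial>\<mu>)
        \<le> ennreal (C1 * r\<^sup>2) * (\<integral>\<^sup>+ y\<in>cball x (C2 * r). grad_sq \<mu> h f y \<partial>\<mu>)"
begin

text \<open>\<open>enn2real\<close> would send an infinite integral to 0; \<open>ennreal_J\<close>
  excludes this for square integrable \<open>g\<close>, whose \<open>\<Gamma>\<close> has finite
  total mass.\<close>

definition J :: "('a \<Rightarrow> real) \<Rightarrow> 'a \<Rightarrow> real \<Rightarrow> real" where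
  "J g x s = enn2real (\<integral>\<^sup>+ y\<in>cball x s. \<Gamma> g y \<partial>\<mu>)"

lemma J_nonneg [simp]: "0 \<le> J g x s"
  by (simp add: J_def)

lemma J_measurable [measurable]:
  assumes [measurable]: "g \<in> borel_measurable \<mu>"
  shows "(\<lambda>x. J g x s) \<in> borel_measurable \<mu>"
  unfolding J_def by measurable

context
  fixes g :: "'a \<Rightarrow> real"
  assumes g [measurable]: "g \<in> borel_measurable \<mu>" and g2: "integrable \<mu> (\<lambda>x. (g x)\<^sup>2)"
begin

lemma nn_integral_\<Gamma>_le: "(\<integral>\<^sup>+ y\<in>A. \<Gamma> g y \<partial>\<mu>) \<le> ennreal (2 * energy g)"
proof -
  have "(\<integral>\<^sup>+ y\<in>A. \<Gamma> g y \<partial>\<mu>) \<le> (\<integral>\<^sup>+ y. \<Gamma> g y \<partial>\<mu>)"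
    by (intro nn_integral_mono) (auto simp: indicator_def)
  thus ?thesis using nn_integral_\<Gamma>[OF g g2] by simp
qed

lemma ennreal_J: "ennreal (J g x s) = (\<integral>\<^sup>+ y\<in>cball x s. \<Gamma> g y \<partial>\<mu>)"
  unfolding J_def using nn_integral_\<Gamma>_le[of "cball x s"]
  by (intro ennreal_enn2real) (simp add: le_less_trans)

lemma J_le: "J g x s \<le> 2 * energy g"
  using nn_integral_\<Gamma>_le[of "cball x s"] nn_integral_\<Gamma>(2)[OF g g2]
  by (simp add: ennreal_J[symmetric])

lemma weighted_average_L2:
  assumes w: "integrable \<mu> w" "\<And>y. 0 \<le> w y" "(\<integral>y. w y \<partial>\<mu>) = 1"
    and w_le: "AE y in \<mu>. w y \<le> A"
  shows "(\<integral>y. w y * g y \<partial>\<mu>)\<^sup>2 \<le> A * (\<integral>y. (g y)\<^sup>2 \<partial>\<mu>)"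
proof -
  \<comment> \<open>A negative bound would force \<open>w\<close> to vanish almost everywhere,
    against total mass 1.\<close>
  have A: "0 \<le> A"
  proof (rule ccontr)
    assume neg: "\<not> 0 \<le> A"
    have "AE y in \<mu>. w y = 0"
      using w_le by eventually_elim (use w(2) neg in \<open>meson order_trans\<close>)
    hence "(\<integral>y. w y \<partial>\<mu>) = (\<integral>y. 0 \<partial>\<mu>)" using w(1) by (intro integral_cong_AE) auto
    thus False using w(3) by simp
  qed
  have "(\<integral>\<^sup>+y. ennreal (w y * (g y)\<^sup>2) \<partial>\<mu>) \<le> (\<integral>\<^sup>+y. ennreal (A * (g y)\<^sup>2) \<partial>\<mu>)"
    using w_le
    by (intro nn_integral_mono_AE, eventually_elim) (intro ennreal_leI mult_right_mono, auto)
  also have "\<dots> = ennreal (A * (\<integral>y. (g y)\<^sup>2 \<partial>\<mu>))"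
    using g2 A by (subst nn_integral_eq_integral) auto
  finally show ?thesis
    using weighted_cauchy_schwarz(2)[OF g w(1,2), of "A * (\<integral>y. (g y)\<^sup>2 \<partial>\<mu>)"] w(3) A by simp
qed

text \<open>Cauchy-Schwarz for \<open>g\<close> minus its ball average, which may be subtracted
  inside because \<open>w\<close> has mass 1. A general density \<open>w\<close> covers both uses:
  the normalised indicator of a smaller ball, and the kernel \<open>p x\<close>, which compares
  \<open>P g x\<close> with an average.\<close>

lemma weighted_average_diff:
  assumes w: "integrable \<mu> w" "\<And>y. 0 \<le> w y" "(\<integral>y. w y \<partial>\<mu>) = 1"
    and w_le: "AE y in \<mu>. w y \<le> A * indicator (cball x r) y" and A: "0 \<le> A" and r: "r \<ge> r0"
  shows "((\<integral>y. w y * g y \<partial>\<mu>) - ball_avg \<mu> g (cball x r))\<^sup>2 \<le> A * (C1 / c * r\<^sup>2 * J g x (C2 * r))"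
proof -
  let ?a = "ball_avg \<mu> g (cball x r)" and ?K = "A * (C1 / c * r\<^sup>2 * J g x (C2 * r))"
  have K0: "0 \<le> ?K" using A C1 c_pos by simp
  have "(\<integral>\<^sup>+y. ennreal (w y * (g y - ?a)\<^sup>2) \<partial>\<mu>)
      \<le> (\<integral>\<^sup>+y. ennreal A * (ennreal ((g y - ?a)\<^sup>2) * indicator (cball x r) y) \<partial>\<mu>)"
    using w_le
  proof (intro nn_integral_mono_AE, eventually_elim)
    fix y assume *: "w y \<le> A * indicator (cball x r) y"
    hence "w y * (g y - ?a)\<^sup>2 \<le> A * indicator (cball x r) y * (g y - ?a)\<^sup>2"
      by (intro mult_right_mono) auto
    thus "ennreal (w y * (g y - ?a)\<^sup>2) \<le> ennreal A * (ennreal ((g y - ?a)\<^sup>2) * indicator (cball x r) y)"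
      using A by (cases "y \<in> cball x r")
        (simp_all add: ennreal_mult[symmetric] ennreal_leI ennreal_neg del: ennreal_mult'')
  qed
  also have "\<dots> = ennreal A * (\<integral>\<^sup>+y\<in>cball x r. ennreal ((g y - ?a)\<^sup>2) \<partial>\<mu>)"
    by (rule nn_integral_cmult) measurable
  also have "\<dots> \<le> ennreal A * (ennreal (C1 / c * r\<^sup>2) * ennreal (J g x (C2 * r)))"
    unfolding ennreal_J using poincare_L2[OF poincare C1 r g g2] by (intro mult_left_mono) auto
  also have "\<dots> = ennreal ?K"
    using A C1 c_pos by (simp add: ennreal_mult[symmetric] del: ennreal_mult'')
  finally have *: "(\<integral>\<^sup>+y. ennreal (w y * (g y - ?a)\<^sup>2) \<partial>\<mu>) \<le> ennreal ?K" .
  have [measurable]: "(\<lambda>y. g y - ?a) \<in> borel_measurable \<mu>" by measurable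
  note cs = weighted_cauchy_schwarz[OF this w(1,2) * K0]
  have "(\<integral>y. w y * g y \<partial>\<mu>) = (\<integral>y. w y * (g y - ?a) + ?a * w y \<partial>\<mu>)"
    by (intro Bochner_Integration.integral_cong) (auto simp: algebra_simps)
  also have "\<dots> = (\<integral>y. w y * (g y - ?a) \<partial>\<mu>) + ?a"
    using cs(1) w by simp
  finally show ?thesis using cs(2) w(3) by simp
qed

lemma ball_avg_weight:
  fixes x :: 'a
  assumes "0 < s"
  defines "w \<equiv> \<lambda>y. indicator (cball x s) y / V \<mu> x s"
  shows "integrable \<mu> w" "\<And>y. 0 \<le> w y" "(\<integral>y. w y \<partial>\<mu>) = 1"
    "ball_avg \<mu> g (cball x s) = (\<integral>y. w y * g y \<partial>\<mu>)"
proof -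
  have v: "V \<mu> x s > 0" using assms by (intro V_pos)
  have i: "integrable \<mu> (indicator (cball x s) :: 'a \<Rightarrow> real)"
    using emeasure_cball_finite by (intro integrable_real_indicator) auto
  show "integrable \<mu> w" unfolding w_def using i by simp
  show "0 \<le> w y" for y by (simp add: w_def)
  show "(\<integral>y. w y \<partial>\<mu>) = 1" using v by (simp add: w_def V_def)
  have "ball_avg \<mu> g (cball x s) = (\<integral>y. indicator (cball x s) y * g y \<partial>\<mu>) / V \<mu> x s"
    by (simp add: ball_avg_def set_lebesgue_integral_def V_def)
  also have "\<dots> = (\<integral>y. w y * g y \<partial>\<mu>)"
    by (subst integral_divide_zero[symmetric]) (simp add: w_def)
  finally show "ball_avg \<mu> g (cball x s) = (\<integral>y. w y * g y \<partial>\<mu>)" .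
qed

lemma P_sq_le: "(P g x)\<^sup>2 \<le> C / V \<mu> x h' * (\<integral>y. (g y)\<^sup>2 \<partial>\<mu>)"
  unfolding P_def
proof (rule weighted_average_L2)
  show "AE y in \<mu>. p x y \<le> C / V \<mu> x h'"
    using p_upper[of x]
    by eventually_elim (use C_pos in \<open>auto simp: indicator_def split: if_splits intro: order_trans\<close>)
qed (simp_all add: p_integrable p_nonneg p_integral)

end

text \<open>
  The square of \<open>2\<^sup>k s A\<^sub>k\<^sup>1\<^sup>/\<^sup>2\<close> with \<open>s = \<rho> / 4\<^sup>k\<close>; the factor \<open>2\<^sup>k\<close> is spent on turning the telescoping sum
  into a maximum over \<open>k\<close> (lemma \<open>geometric_sum_le_max\<close>).
\<close>

definition T :: "('a \<Rightarrow> real) \<Rightarrow> real \<Rightarrow> nat \<Rightarrow> 'a \<Rightarrow> real" where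
  "T g \<rho> k x = \<rho>\<^sup>2 / 4 ^ k * (1 / V \<mu> x (\<rho> / 4 ^ k) * J g x (4 * C2 * (\<rho> / 4 ^ k)))"

lemma T_nonneg [simp]: "0 \<le> T g \<rho> k x"
  by (simp add: T_def)

text \<open>Telescopes from \<open>P g x\<close> through the averages over
  \<open>cball x (\<rho> / 4 ^ k)\<close>, from \<open>k = n\<close> (radius \<open>R0\<close>) up
  to \<open>k = 0\<close> (radius \<open>\<rho>\<close>). The largest average is controlled by the
  L2 norm. The index \<open>k\<close> may depend on \<open>x\<close>, while \<open>L\<close> depends
  on neither \<open>g\<close>, \<open>x\<close> nor \<open>n\<close>.\<close>

lemma P_sq_le_T:
  fixes R0 :: real
  assumes R0: "R0 \<ge> r0" "R0 \<ge> h'"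
  shows "\<exists>L>0. \<forall>g x \<rho> n. g \<in> borel_measurable \<mu> \<longrightarrow> integrable \<mu> (\<lambda>x. (g x)\<^sup>2) \<longrightarrow> \<rho> = 4 ^ n * R0 \<longrightarrow>
    (\<exists>k\<le>n. (P g x)\<^sup>2 \<le> L * (T g \<rho> k x + (\<integral>y. (g y)\<^sup>2 \<partial>\<mu>) / V \<mu> x \<rho>))"
proof -
  have R0_pos: "R0 > 0" using R0 r0 by simp
  obtain D where D: "D \<ge> 1" "\<And>x t. t \<ge> h' \<Longrightarrow> V \<mu> x (R0 / h' * t) \<le> D * V \<mu> x t"
    using doubling[OF h'_pos] by blast
  have V_R0: "V \<mu> x R0 \<le> D * V \<mu> x h'" for x using D(2)[of h' x] h'_pos by simp
  \<comment> \<open>The 16 is the square of the ratio 4 of successive radii; \<open>C * D\<close>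
    comes from the kernel bound \<open>C / V \<mu> x h'\<close> once the volume is moved to radius
    \<open>R0\<close>.\<close>
  define \<beta> where "\<beta> = C1 / c * (16 + C * D)"
  have \<beta>: "\<beta> > 0" "C1 / c * 16 \<le> \<beta>" "C1 / c * (C * D) \<le> \<beta>"
  proof -
    have "C * D > 0" "C1 / c > 0" using C1 c_pos C_pos D(1) by auto
    thus "\<beta> > 0" "C1 / c * 16 \<le> \<beta>" "C1 / c * (C * D) \<le> \<beta>"
      unfolding \<beta>_def by (intro mult_pos_pos mult_left_mono; simp)+
  qed
  have "\<exists>k\<le>n. (P g x)\<^sup>2 \<le> (32 * \<beta> + 2) * (T g \<rho> k x + (\<integral>y. (g y)\<^sup>2 \<partial>\<mu>) / V \<mu> x \<rho>)"
    if g: "g \<in> borel_measurable \<mu>" and g2: "integrable \<mu> (\<lambda>x. (g x)\<^sup>2)" and \<rho>: "\<rho> = 4 ^ n * R0" for g x \<rho> n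
  proof -
    define s where "s k = \<rho> / 4 ^ k" for k :: nat
    define a where "a k = ball_avg \<mu> g (cball x (s k))" for k
    define u where "u k = sqrt (T g \<rho> k x)" for k
    have \<rho>_pos: "\<rho> > 0" using R0_pos by (simp add: \<rho>)
    have s_pos: "s k > 0" for k using \<rho>_pos by (simp add: s_def)
    have s_Suc: "s k = 4 * s (Suc k)" for k by (simp add: s_def)
    have s_n: "s n = R0" by (simp add: s_def \<rho>)
    have s_ge: "s k \<ge> R0" if "k \<le> n" for k
    proof -
      have "(4::real) ^ k \<le> 4 ^ n" using that by (intro power_increasing) auto
      thus ?thesis using R0_pos by (simp add: s_def \<rho> field_simps)
    qed
    have sT: "(s k)\<^sup>2 * (1 / V \<mu> x (s k) * J g x (4 * C2 * s k)) = (1 / 4) ^ k * T g \<rho> k x" for k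
      by (simp add: T_def s_def power2_eq_square power_divide)
    have root: "\<bar>d\<bar> \<le> sqrt \<beta> * ((1 / 2) ^ k * u k)" if "d\<^sup>2 \<le> \<beta> * ((1 / 4) ^ k * T g \<rho> k x)" for d k
    proof -
      have "\<bar>d\<bar> \<le> sqrt (\<beta> * ((1 / 4) ^ k * T g \<rho> k x))"
        using that by (metis real_sqrt_abs real_sqrt_le_iff)
      also have "\<dots> = sqrt \<beta> * (sqrt ((1 / 4) ^ k) * u k)"
        by (simp add: real_sqrt_mult u_def)
      also have "sqrt ((1 / 4) ^ k) = (1 / 2) ^ k"
        by (simp add: real_sqrt_power real_sqrt_divide)
      finally show ?thesis .
    qed
    \<comment> \<open>The Poincare inequality is used on the larger ball, of radius
      \<open>s k\<close>, with the density of the smaller one as weight. The difference is charged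
      to the index \<open>Suc k\<close>, where \<open>C2 * s k\<close> equals
      \<open>4 * C2 * s (Suc k)\<close>, the radius in \<open>T\<close>.\<close>
    have step: "\<bar>a (Suc k) - a k\<bar> \<le> sqrt \<beta> * ((1 / 2) ^ Suc k * u (Suc k))" if k: "Suc k \<le> n" for k
    proof (rule root)
      have "(a (Suc k) - a k)\<^sup>2 \<le> 1 / V \<mu> x (s (Suc k)) * (C1 / c * (s k)\<^sup>2 * J g x (C2 * s k))"
        unfolding a_def ball_avg_weight(4)[OF g g2 s_pos[of "Suc k"]]
      proof (rule weighted_average_diff[OF g g2 ball_avg_weight(1-3)[OF g g2 s_pos]])
        have "s (Suc k) \<le> s k" using s_Suc[of k] s_pos[of "Suc k"] by linarith
        thus "AE y in \<mu>. indicator (cball x (s (Suc k))) y / V \<mu> x (s (Suc k))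
            \<le> 1 / V \<mu> x (s (Suc k)) * indicator (cball x (s k)) y"
          by (intro AE_I2) (auto simp: indicator_def)
        show "s k \<ge> r0" using s_ge[of k] k R0 by simp
      qed simp
      also have "\<dots> = C1 / c * 16 * ((s (Suc k))\<^sup>2 * (1 / V \<mu> x (s (Suc k)) * J g x (4 * C2 * s (Suc k))))"
        unfolding s_Suc[of k] by (simp add: power2_eq_square mult_ac)
      also have "\<dots> \<le> \<beta> * ((1 / 4) ^ Suc k * T g \<rho> (Suc k) x)"
        unfolding sT using \<beta>(2) by (intro mult_right_mono) auto
      finally show "(a (Suc k) - a k)\<^sup>2 \<le> \<beta> * ((1 / 4) ^ Suc k * T g \<rho> (Suc k) x)" .
    qed
    \<comment> \<open>Since \<open>R0 \<ge> h'\<close>, the kernel \<open>p x\<close> lives on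
      \<open>cball x (s n)\<close> up to a null set and is an admissible weight there.\<close>
    have last: "\<bar>P g x - a n\<bar> \<le> sqrt \<beta> * ((1 / 2) ^ n * u n)"
    proof (rule root)
      have v: "V \<mu> x h' > 0" "V \<mu> x R0 > 0" using V_pos h'_pos R0_pos by auto
      have "(P g x - a n)\<^sup>2 \<le> C / V \<mu> x h' * (C1 / c * (s n)\<^sup>2 * J g x (C2 * s n))"
        unfolding a_def P_def
      proof (rule weighted_average_diff[OF g g2])
        show "AE y in \<mu>. p x y \<le> C / V \<mu> x h' * indicator (cball x (s n)) y"
          using p_upper[of x]
        proof eventually_elim
          case (elim y)
          thus ?case using C_pos R0(2) s_n by (auto simp: indicator_def split: if_splits intro: order_trans)
        qed
      qed (use p_integrable p_nonneg p_integral C_pos R0 s_n in auto)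
      also have "\<dots> \<le> (C * D / V \<mu> x (s n)) * (C1 / c * (s n)\<^sup>2 * J g x (4 * C2 * s n))"
      proof (intro mult_mono)
        show "C / V \<mu> x h' \<le> C * D / V \<mu> x (s n)"
          using V_R0[of x] v C_pos by (simp add: s_n field_simps)
        have "ennreal (J g x (C2 * s n)) \<le> ennreal (J g x (4 * C2 * s n))"
        proof -
          have "C2 * s n \<le> 4 * C2 * s n" using C2 s_pos[of n] by simp
          hence "cball x (C2 * s n) \<subseteq> cball x (4 * C2 * s n)" by (rule subset_cball)
          thus ?thesis unfolding ennreal_J[OF g g2]
            by (intro nn_integral_mono mult_left_mono indicator_leI) auto
        qed
        thus "J g x (C2 * s n) \<le> J g x (4 * C2 * s n)" by simp
      qed (use C1 c_pos C_pos D in auto)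
      also have "\<dots> = C1 / c * (C * D) * ((s n)\<^sup>2 * (1 / V \<mu> x (s n) * J g x (4 * C2 * s n)))"
        by (simp add: mult_ac)
      also have "\<dots> \<le> \<beta> * ((1 / 4) ^ n * T g \<rho> n x)"
        unfolding sT using \<beta>(3) by (intro mult_right_mono) auto
      finally show "(P g x - a n)\<^sup>2 \<le> \<beta> * ((1 / 4) ^ n * T g \<rho> n x)" .
    qed
    have tele: "\<bar>a k - a 0\<bar> \<le> sqrt \<beta> * (\<Sum>i\<in>{1..k}. (1 / 2) ^ i * u i)" if "k \<le> n" for k
      using that
    proof (induction k)
      case (Suc k)
      hence "\<bar>a k - a 0\<bar> + \<bar>a (Suc k) - a k\<bar> \<le> sqrt \<beta> * (\<Sum>i\<in>{1..k}. (1 / 2) ^ i * u i)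
          + sqrt \<beta> * ((1 / 2) ^ Suc k * u (Suc k))"
        by (intro add_mono step) auto
      thus ?case by (simp add: algebra_simps)
    qed simp
    have u0: "0 \<le> u k" for k by (simp add: u_def)
    define S where "S = (\<Sum>i\<le>n. (1 / 2) ^ i * u i)"
    have S: "(\<Sum>i\<in>{1..n}. (1 / 2) ^ i * u i) \<le> S" "(1 / 2) ^ n * u n \<le> S"
      unfolding S_def using u0 by (auto intro!: sum_mono2 member_le_sum)
    obtain k where k: "k \<le> n" "S \<le> 2 * u k"
      using geometric_sum_le_max[of u n] u0 unfolding S_def by blast
    \<comment> \<open>The index \<open>n\<close> occurs in both pieces, so each is bounded by the
      full sum \<open>S\<close> separately; this gives the factor 4, hence 16 after squaring.
      Splitting off \<open>a 0\<close> by \<open>(u + v)^2 \<le> 2 * u^2 + 2 * v^2\<close> leads to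
      the constant \<open>32 * \<beta> + 2\<close>.\<close>
    have "\<bar>P g x - a 0\<bar> \<le> \<bar>P g x - a n\<bar> + \<bar>a n - a 0\<bar>" by linarith
    also have "\<dots> \<le> sqrt \<beta> * ((1 / 2) ^ n * u n) + sqrt \<beta> * (\<Sum>i\<in>{1..n}. (1 / 2) ^ i * u i)"
      by (intro add_mono last tele) simp
    also have "\<dots> \<le> sqrt \<beta> * (2 * u k) + sqrt \<beta> * (2 * u k)"
      using S k(2) \<beta>(1) by (intro add_mono mult_left_mono) auto
    finally have "\<bar>P g x - a 0\<bar> \<le> 4 * (sqrt \<beta> * u k)" by simp
    hence "\<bar>P g x - a 0\<bar>\<^sup>2 \<le> (4 * (sqrt \<beta> * u k))\<^sup>2" by (intro power_mono) auto
    hence diff: "(P g x - a 0)\<^sup>2 \<le> 16 * \<beta> * T g \<rho> k x"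
      using \<beta>(1) by (simp add: power_mult_distrib u_def)
    have "(a 0)\<^sup>2 \<le> 1 / V \<mu> x (s 0) * (\<integral>y. (g y)\<^sup>2 \<partial>\<mu>)"
      unfolding a_def ball_avg_weight(4)[OF g g2 s_pos]
      by (rule weighted_average_L2[OF g g2 ball_avg_weight(1-3)[OF g g2 s_pos]])
        (auto simp: indicator_def)
    hence a0: "(a 0)\<^sup>2 \<le> (\<integral>y. (g y)\<^sup>2 \<partial>\<mu>) / V \<mu> x \<rho>" by (simp add: s_def)
    have "(P g x)\<^sup>2 \<le> 2 * (P g x - a 0)\<^sup>2 + 2 * (a 0)\<^sup>2"
      using sum_squares_bound[of "P g x - a 0" "a 0"] by (simp add: power2_eq_square algebra_simps)
    also have "\<dots> \<le> 32 * \<beta> * T g \<rho> k x + 2 * ((\<integral>y. (g y)\<^sup>2 \<partial>\<mu>) / V \<mu> x \<rho>)"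
      using diff a0 by simp
    also have "\<dots> \<le> (32 * \<beta> + 2) * T g \<rho> k x + (32 * \<beta> + 2) * ((\<integral>y. (g y)\<^sup>2 \<partial>\<mu>) / V \<mu> x \<rho>)"
      using \<beta>(1) by (intro add_mono mult_right_mono) auto
    also have "\<dots> = (32 * \<beta> + 2) * (T g \<rho> k x + (\<integral>y. (g y)\<^sup>2 \<partial>\<mu>) / V \<mu> x \<rho>)"
      by (rule distrib_left[symmetric])
    finally show ?thesis using k(1) by blast
  qed
  thus ?thesis using \<beta>(1) by (intro exI[of _ "32 * \<beta> + 2"]) auto
qed

end

section \<open>The integral estimate on a ball\<close>

context poincare_markov_space
begin

lemma T_measurable [measurable]:
  assumes [measurable]: "g \<in> borel_measurable \<mu>"
  shows "T g \<rho> k \<in> borel_measurable \<mu>"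
  unfolding T_def[abs_def] by measurable

text \<open>Feeds the telescoped bound into \<open>nn_integral_powr_le\<close>; \<open>m\<close> and
  \<open>A\<close> are fixed before \<open>g\<close>, \<open>x0\<close> and \<open>r\<close>. With
  \<open>Y = (r\<^sup>2 * E + N) / v\<close>, both the energy and the norm contributions are
  multiples of \<open>Y\<close>.\<close>

lemma P_powr_le:
  "\<exists>m>0. \<exists>A>0. \<forall>g x0 r. g \<in> borel_measurable \<mu> \<longrightarrow> integrable \<mu> (\<lambda>x. (g x)\<^sup>2) \<longrightarrow> 0 < r \<longrightarrow>
    (\<integral>\<^sup>+x\<in>cball x0 r. ennreal ((P g x)\<^sup>2 powr (1 + 1 / real m)) \<partial>\<mu>) \<le>
    ennreal (3 * V \<mu> x0 r * (A * ((r\<^sup>2 * energy g + (\<integral>x. (g x)\<^sup>2 \<partial>\<mu>)) / V \<mu> x0 r)) powr (1 + 1 / real m))"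
proof -
  define R0 where "R0 = max r0 h'"
  have R0: "R0 \<ge> r0" "R0 \<ge> h'" "R0 > 0" using r0 by (auto simp: R0_def)
  obtain L where L: "L > 0" "\<And>g x \<rho> n. g \<in> borel_measurable \<mu> \<Longrightarrow> integrable \<mu> (\<lambda>x. (g x)\<^sup>2) \<Longrightarrow>
      \<rho> = 4 ^ n * R0 \<Longrightarrow> \<exists>k\<le>n. (P g x)\<^sup>2 \<le> L * (T g \<rho> k x + (\<integral>y. (g y)\<^sup>2 \<partial>\<mu>) / V \<mu> x \<rho>)"
    using P_sq_le_T[OF R0(1,2)] by metis
  obtain D where D: "D \<ge> 1" "\<And>x t. t \<ge> R0 \<Longrightarrow> V \<mu> x (4 * t) \<le> D * V \<mu> x t"
    using doubling[OF R0(3)] by blast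
  obtain D2 where D2: "D2 \<ge> 1" "\<And>x t. t \<ge> R0 \<Longrightarrow> V \<mu> x (2 * t) \<le> D2 * V \<mu> x t"
    using doubling[OF R0(3)] by blast
  obtain D3 where D3: "D3 \<ge> 1" "\<And>H s. H \<in> borel_measurable \<mu> \<Longrightarrow> s \<ge> R0 \<Longrightarrow>
    (\<integral>\<^sup>+x. ennreal (1 / V \<mu> x s) * (\<integral>\<^sup>+y\<in>cball x (4 * C2 * s). H y \<partial>\<mu>) \<partial>\<mu>) \<le> ennreal D3 * (\<integral>\<^sup>+x. H x \<partial>\<mu>)"
    using nn_integral_averages_le[OF R0(3), of "4 * C2"] C2 by auto
  obtain D4 where D4: "D4 \<ge> 1" "\<And>x t. t \<ge> h' \<Longrightarrow> V \<mu> x (2 * R0 / h' * t) \<le> D4 * V \<mu> x t"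
    using doubling[OF h'_pos] by blast
  \<comment> \<open>This fixes the exponent: \<open>D\<close> is the cost of dilation by 4, the
    ratio of successive scales, and the interpolation requires \<open>D \<le> 2 ^ m\<close>.\<close>
  obtain m where m: "D < 2 ^ m" using real_arch_pow[of 2 D] by auto
  hence "m > 0" using D(1) by (cases m) auto
  have V_iterate: "V \<mu> x (4 ^ k * t) \<le> D ^ k * V \<mu> x t" if t: "t \<ge> R0" for x t and k :: nat
  proof (induction k)
    case (Suc k)
    have "1 * R0 \<le> 4 ^ k * t" using t R0(3) by (intro mult_mono) auto
    hence "V \<mu> x (4 * (4 ^ k * t)) \<le> D * V \<mu> x (4 ^ k * t)" by (intro D) simp
    also have "\<dots> \<le> D * (D ^ k * V \<mu> x t)" using Suc D(1) by (intro mult_left_mono) auto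
    finally show ?case by (simp add: mult_ac)
  qed simp
  \<comment> \<open>The 32 is 16, from \<open>\<rho>\<^sup>2 \<le> 16 * r\<^sup>2\<close>, times 2,
    from the total mass \<open>2 * E\<close> of \<open>\<Gamma> g\<close>.\<close>
  define A where "A = 32 * (D2 + D3)"
  define L' where "L' = L + C * D4"
  have A: "A \<ge> 1" "32 * D2 \<le> A" "32 * D3 \<le> A" using D2(1) D3(1) by (auto simp: A_def)
  have L': "L' > 0" "L \<le> L'" "C * D4 \<le> L'"
    using L(1) C_pos D4(1) by (auto simp: L'_def intro!: add_pos_pos)
  have "(\<integral>\<^sup>+x\<in>cball x0 r. ennreal ((P g x)\<^sup>2 powr (1 + 1 / real m)) \<partial>\<mu>) \<le>
      ennreal (3 * V \<mu> x0 r * (2 * L' * A * ((r\<^sup>2 * energy g + (\<integral>x. (g x)\<^sup>2 \<partial>\<mu>)) / V \<mu> x0 r)) powr (1 + 1 / real m))"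
    if [measurable]: "g \<in> borel_measurable \<mu>" and g2: "integrable \<mu> (\<lambda>x. (g x)\<^sup>2)" and r: "0 < r" for g x0 r
  proof -
    define v where "v = V \<mu> x0 r"
    define E where "E = energy g"
    define N where "N = (\<integral>x. (g x)\<^sup>2 \<partial>\<mu>)"
    define Y where "Y = (r\<^sup>2 * E + N) / v"
    have v: "v > 0" using V_pos[OF r] by (simp add: v_def)
    have E: "E \<ge> 0" unfolding E_def by (rule nn_integral_\<Gamma>(2)[OF _ g2]) measurable
    have N: "N \<ge> 0" by (simp add: N_def)
    have Y: "Y \<ge> 0" "r\<^sup>2 * E / v \<le> Y" "N / v \<le> Y"
      using v E N by (auto simp: Y_def intro!: divide_right_mono)
    have vY: "v * Y = r\<^sup>2 * E + N" using v by (simp add: Y_def)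
    note core = nn_integral_powr_le[where M = \<mu> and B = "cball x0 r" and v = v and D = D and m = m
        and A = A and Y = Y and L = L' and F = "\<lambda>x. (P g x)\<^sup>2"]
    have "(\<integral>\<^sup>+x\<in>cball x0 r. ennreal ((P g x)\<^sup>2 powr (1 + 1 / real m)) \<partial>\<mu>) \<le>
      ennreal (3 * v * (2 * L' * A * Y) powr (1 + 1 / real m))"
    proof (cases "r \<ge> R0")
      case True
      \<comment> \<open>Minimality places \<open>\<rho>\<close> between \<open>r\<close> and
        \<open>4 * r\<close>; for \<open>n = 0\<close> this uses \<open>R0 \<le> r\<close>.\<close>
      define n where "n = (LEAST n. r \<le> 4 ^ n * R0)"
      define \<rho> where "\<rho> = 4 ^ n * R0"
      obtain n0 where "r / R0 < 4 ^ n0" using real_arch_pow[of 4 "r / R0"] by auto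
      hence "r \<le> 4 ^ n0 * R0" using R0(3) by (simp add: field_simps)
      hence \<rho>_ge: "r \<le> \<rho>" unfolding \<rho>_def n_def by (rule LeastI)
      have \<rho>_le: "\<rho> \<le> 4 * r"
      proof (cases n)
        case 0
        thus ?thesis using True r by (simp add: \<rho>_def)
      next
        case (Suc k)
        hence "\<not> r \<le> 4 ^ k * R0" using not_less_Least[of k "\<lambda>n. r \<le> 4 ^ n * R0"] by (simp add: n_def)
        thus ?thesis by (simp add: \<rho>_def Suc)
      qed
      have \<rho>: "\<rho> > 0" "\<rho>\<^sup>2 \<le> 16 * r\<^sup>2"
        using \<rho>_ge r power_mono[OF \<rho>_le, of 2] by (auto simp: power_mult_distrib)
      have scale: "\<rho> / 4 ^ k \<ge> R0" if "k \<le> n" for k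
      proof -
        have "(4::real) ^ k \<le> 4 ^ n" using that by (intro power_increasing) auto
        thus ?thesis using R0(3) by (simp add: \<rho>_def field_simps)
      qed
      have V_\<rho>: "v \<le> D2 * V \<mu> x \<rho>" if "x \<in> cball x0 r" for x
      proof -
        have "v \<le> V \<mu> x (2 * \<rho>)"
          unfolding v_def using that \<rho>_ge by (intro V_mono_dist) auto
        also have "\<dots> \<le> D2 * V \<mu> x \<rho>" using True \<rho>_ge by (intro D2) auto
        finally show ?thesis .
      qed
      show ?thesis
      proof (rule core[where n = n and T = "T g \<rho>"])
        \<comment> \<open>Supremum bound: shrinking the ball from \<open>\<rho>\<close> to
          \<open>\<rho> / 4 ^ k\<close> costs \<open>D ^ k\<close> in volume, and \<open>J\<close>
          is at most the total mass.\<close>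
        fix k x assume k: "k \<le> n" and x: "x \<in> cball x0 r"
        have V_pos': "V \<mu> x (\<rho> / 4 ^ k) > 0" using \<rho> by (intro V_pos) auto
        have "v \<le> D2 * V \<mu> x \<rho>" by (rule V_\<rho>[OF x])
        also have "\<dots> \<le> D2 * (D ^ k * V \<mu> x (\<rho> / 4 ^ k))"
          using V_iterate[OF scale[OF k], of x k] D2(1) by (intro mult_left_mono) auto
        finally have "1 / V \<mu> x (\<rho> / 4 ^ k) \<le> D2 * D ^ k / v"
          using v V_pos' by (simp add: field_simps)
        moreover have "J g x (4 * C2 * (\<rho> / 4 ^ k)) \<le> 2 * E"
          unfolding E_def by (rule J_le[OF _ g2]) measurable
        ultimately have "T g \<rho> k x \<le> 16 * r\<^sup>2 / 4 ^ k * (D2 * D ^ k / v * (2 * E))"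
          unfolding T_def using \<rho> v D D2 E
          by (intro mult_mono divide_right_mono) auto
        also have "\<dots> = 32 * D2 * D ^ k / 4 ^ k * (r\<^sup>2 * E / v)" by simp
        also have "\<dots> \<le> A * D ^ k / 4 ^ k * Y"
          using A Y D E v by (intro mult_mono divide_right_mono mult_right_mono) auto
        finally show "T g \<rho> k x \<le> A * D ^ k / 4 ^ k * Y" .
      next
        \<comment> \<open>Integral bound: averaging costs only \<open>D3\<close>, at every scale, so
          the decay \<open>4 ^ k\<close> survives in full.\<close>
        fix k assume k: "k \<le> n"
        let ?s = "\<rho> / 4 ^ k"
        have "(\<integral>\<^sup>+x\<in>cball x0 r. ennreal (T g \<rho> k x) \<partial>\<mu>) \<le> (\<integral>\<^sup>+x. ennreal (T g \<rho> k x) \<partial>\<mu>)"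
          by (intro nn_integral_mono) (auto simp: indicator_def)
        also have "\<dots> = (\<integral>\<^sup>+x. ennreal (\<rho>\<^sup>2 / 4 ^ k) *
            (ennreal (1 / V \<mu> x ?s) * (\<integral>\<^sup>+y\<in>cball x (4 * C2 * ?s). \<Gamma> g y \<partial>\<mu>)) \<partial>\<mu>)"
        proof (intro nn_integral_cong)
          fix x
          have "(\<integral>\<^sup>+y\<in>cball x (4 * C2 * ?s). \<Gamma> g y \<partial>\<mu>) = ennreal (J g x (4 * C2 * ?s))"
            by (rule ennreal_J[OF _ g2, symmetric]) measurable
          thus "ennreal (T g \<rho> k x) = ennreal (\<rho>\<^sup>2 / 4 ^ k) *
            (ennreal (1 / V \<mu> x ?s) * (\<integral>\<^sup>+y\<in>cball x (4 * C2 * ?s). \<Gamma> g y \<partial>\<mu>))"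
            unfolding T_def by (simp only:) (simp add: ennreal_mult[symmetric] del: ennreal_mult'')
        qed
        also have "\<dots> = ennreal (\<rho>\<^sup>2 / 4 ^ k) *
            (\<integral>\<^sup>+x. ennreal (1 / V \<mu> x ?s) * (\<integral>\<^sup>+y\<in>cball x (4 * C2 * ?s). \<Gamma> g y \<partial>\<mu>) \<partial>\<mu>)"
          by (rule nn_integral_cmult) measurable
        also have "\<dots> \<le> ennreal (\<rho>\<^sup>2 / 4 ^ k) * (ennreal D3 * (\<integral>\<^sup>+x. \<Gamma> g x \<partial>\<mu>))"
          by (intro mult_left_mono D3 scale k \<Gamma>_measurable) auto
        also have "(\<integral>\<^sup>+x. \<Gamma> g x \<partial>\<mu>) = ennreal (2 * E)"
          unfolding E_def by (rule nn_integral_\<Gamma>(1)[OF _ g2]) measurable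
        also have "ennreal (\<rho>\<^sup>2 / 4 ^ k) * (ennreal D3 * ennreal (2 * E)) = ennreal (\<rho>\<^sup>2 / 4 ^ k * (D3 * (2 * E)))"
          using D3(1) E by (simp only: ennreal_mult[symmetric] mult_nonneg_nonneg zero_le_numeral order_trans[OF zero_le_one]
            divide_nonneg_nonneg zero_le_power zero_le_power2)
        also have "\<dots> \<le> ennreal (A / 4 ^ k * v * Y)"
        proof (intro ennreal_leI)
          have "\<rho>\<^sup>2 / 4 ^ k * (D3 * (2 * E)) \<le> 16 * r\<^sup>2 / 4 ^ k * (D3 * (2 * E))"
            using \<rho> D3(1) E by (intro mult_right_mono divide_right_mono) auto
          also have "\<dots> = 32 * D3 / 4 ^ k * (r\<^sup>2 * E)" by simp
          also have "\<dots> \<le> A / 4 ^ k * (v * Y)"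
            unfolding vY using A E N by (intro mult_mono divide_right_mono) auto
          finally show "\<rho>\<^sup>2 / 4 ^ k * (D3 * (2 * E)) \<le> A / 4 ^ k * v * Y" by (simp add: mult.assoc)
        qed
        finally show "(\<integral>\<^sup>+x\<in>cball x0 r. ennreal (T g \<rho> k x) \<partial>\<mu>) \<le> ennreal (A / 4 ^ k * v * Y)" .
      next
        fix x assume x: "x \<in> cball x0 r"
        have "V \<mu> x \<rho> > 0" using \<rho> by (intro V_pos)
        hence "N / V \<mu> x \<rho> \<le> D2 * (N / v)"
          using mult_left_mono[OF V_\<rho>[OF x] N] v by (simp add: field_simps)
        also have "\<dots> \<le> A * Y"
          using A Y D2 N v by (intro mult_mono) auto
        finally have *: "N / V \<mu> x \<rho> \<le> A * Y" .
        obtain k where k: "k \<le> n" "(P g x)\<^sup>2 \<le> L * (T g \<rho> k x + N / V \<mu> x \<rho>)"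
          using L(2)[OF _ g2 \<rho>_def, of x] unfolding N_def by auto
        note k(2)
        also have "L * (T g \<rho> k x + N / V \<mu> x \<rho>) \<le> L' * (T g \<rho> k x + A * Y)"
          using * L L' N by (intro mult_mono add_left_mono) auto
        finally show "\<exists>k\<le>n. (P g x)\<^sup>2 \<le> L' * (T g \<rho> k x + A * Y)" using k(1) by blast
      qed (use m \<open>m > 0\<close> D A Y L' v in \<open>auto simp: emeasure_cball v_def\<close>)
    next
      case False
      \<comment> \<open>For small radii there is nothing to telescope. With \<open>T = 0\<close> the
        pointwise bound \<open>P_sq_le\<close> suffices, as \<open>D4\<close> compares
        \<open>V \<mu> x h'\<close> with the volume of the whole ball.\<close>
      show ?thesis
      proof (rule core[where n = 0 and T = "\<lambda>_ _. 0"])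
        fix x assume x: "x \<in> cball x0 r"
        have "v \<le> V \<mu> x (2 * R0)"
          unfolding v_def using x False by (intro V_mono_dist) auto
        also have "\<dots> \<le> D4 * V \<mu> x h'" using D4(2)[of h' x] h'_pos by simp
        finally have "1 / V \<mu> x h' \<le> D4 / v"
          using v V_pos[OF h'_pos, of x] by (simp add: field_simps)
        hence "C / V \<mu> x h' * N \<le> C * (D4 / v) * N"
          using C_pos N by (intro mult_right_mono) (auto simp: divide_inverse)
        moreover have "(P g x)\<^sup>2 \<le> C / V \<mu> x h' * N"
          unfolding N_def by (rule P_sq_le[OF _ g2]) measurable
        ultimately have "(P g x)\<^sup>2 \<le> C * D4 * (1 * (N / v))" by simp
        also have "\<dots> \<le> L' * (A * Y)"
          using L' A Y N v C_pos D4(1) by (intro mult_mono) auto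
        finally show "\<exists>k\<le>0::nat. (P g x)\<^sup>2 \<le> L' * (0 + A * Y)"
          by (intro exI[of _ 0]) simp
      qed (use m \<open>m > 0\<close> D A Y L' v in \<open>auto simp: emeasure_cball v_def\<close>)
    qed
    thus ?thesis by (simp add: v_def E_def N_def Y_def)
  qed
  moreover have "2 * L' * A > 0" using L' A by simp
  ultimately show ?thesis using \<open>m > 0\<close> by blast
qed

end

section \<open>The Sobolev inequality\<close>

theorem theorem5p1:
  fixes \<mu> :: "'a::metric_space measure" and p :: "'a \<Rightarrow> 'a \<Rightarrow> real" and b h h' :: real
  assumes "locally_compact_space (euclidean :: 'a topology)"
    and "radon_full_support \<mu>"
    and "b > 0" and "quasi_b_geodesic b TYPE('a)"
    and "VD_loc \<mu>" and "VD_inf \<mu>"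
    and "h > 0" and "poincare \<mu> h"
    and "markov_kernel \<mu> p" and "compatible \<mu> p h h'"
  shows "\<exists>\<delta>>2. \<exists>C_S>0. \<forall>r>0. \<forall>x. \<forall>f\<in>L2_on \<mu> (cball x r).
           (Lp_norm_on \<mu> (cball x r) (2 * \<delta> / (\<delta> - 2)) (P_B \<mu> p (cball x r) f))\<^sup>2
           \<le> C_S * r\<^sup>2 / V \<mu> x r powr (2 / \<delta>) *
             (energy_B \<mu> p (cball x r) f + Lp_norm_on \<mu> (cball x r) 2 f ^ 2 / r\<^sup>2)"
proof -
  interpret doubling_space \<mu> by (rule doubling_spaceI[OF assms(1,2,5,6)])
  have "\<exists>c>0. \<exists>C>0. \<forall>x. AE y in \<mu>.
        c / V \<mu> x h * indicator (cball x h) y \<le> p x y \<and>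
        p x y \<le> C / V \<mu> x h' * indicator (cball x h') y"
    using assms(10) unfolding compatible_def by blast
  then obtain c C where cC: "c > 0" "C > 0"
    "\<And>x. AE y in \<mu>. c / V \<mu> x h * indicator (cball x h) y \<le> p x y \<and>
        p x y \<le> C / V \<mu> x h' * indicator (cball x h') y"
    by blast
  obtain C1 C2 r0 where PI: "C1 > 0" "C2 \<ge> 1" "r0 > 0"
    "\<forall>f\<in>L_inf_loc \<mu>. \<forall>x r. r \<ge> r0 \<longrightarrow>
      (\<integral>\<^sup>+ y\<in>cball x r. ennreal ((f y - ball_avg \<mu> f (cball x r))\<^sup>2) \<partial>\<mu>)
        \<le> ennreal (C1 * r\<^sup>2) * (\<integral>\<^sup>+ y\<in>cball x (C2 * r). grad_sq \<mu> h f y \<partial>\<mu>)"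
    using assms(8) unfolding poincare_def by (elim exE conjE) (rule that)
  interpret poincare_markov_space \<mu> p h h' c C r0 C1 C2
  proof unfold_locales
    show "AE y in \<mu>. c / V \<mu> x h * indicator (cball x h) y \<le> p x y" for x
      using cC(3)[of x] by eventually_elim simp
    show "AE y in \<mu>. p x y \<le> C / V \<mu> x h' * indicator (cball x h') y" for x
      using cC(3)[of x] by eventually_elim simp
    show "AE z in \<mu> \<Otimes>\<^sub>M \<mu>. p (fst z) (snd z) = p (snd z) (fst z)" and "h \<le> h'"
      using assms(10) by (simp_all add: compatible_def)
    show "(\<integral>\<^sup>+ y\<in>cball x r. ennreal ((f y - ball_avg \<mu> f (cball x r))\<^sup>2) \<partial>\<mu>)
        \<le> ennreal (C1 * r\<^sup>2) * (\<integral>\<^sup>+ y\<in>cball x (C2 * r). grad_sq \<mu> h f y \<partial>\<mu>)"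
      if "f \<in> L_inf_loc \<mu>" "r \<ge> r0" for f x r
      using PI(4) that by blast
  qed (use assms(7,9) cC(1,2) PI(1-3) in \<open>simp_all add: markov_kernel_def split_beta'\<close>)
  obtain m A where m: "m > 0" and A: "A > 0" and main: "\<And>g x0 r. g \<in> borel_measurable \<mu> \<Longrightarrow>
    integrable \<mu> (\<lambda>x. (g x)\<^sup>2) \<Longrightarrow> 0 < r \<Longrightarrow>
    (\<integral>\<^sup>+x\<in>cball x0 r. ennreal ((P g x)\<^sup>2 powr (1 + 1 / real m)) \<partial>\<mu>) \<le>
    ennreal (3 * V \<mu> x0 r * (A * ((r\<^sup>2 * energy g + (\<integral>x. (g x)\<^sup>2 \<partial>\<mu>)) / V \<mu> x0 r)) powr (1 + 1 / real m))"
    using P_powr_le by blast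
  define \<kappa> where "\<kappa> = 1 + 1 / real m"
  \<comment> \<open>Chosen so that \<open>\<delta> / (\<delta> - 2) = \<kappa>\<close>.\<close>
  define \<delta> where "\<delta> = 2 + 2 * real m"
  have \<kappa>: "\<kappa> > 1" and \<delta>: "\<delta> > 2" using m by (auto simp: \<kappa>_def \<delta>_def)
  have q: "2 * \<delta> / (\<delta> - 2) = 2 * \<kappa>" and e: "1 / \<kappa> - 1 = - (2 / \<delta>)"
    using m by (auto simp: \<kappa>_def \<delta>_def field_simps)
  have "(Lp_norm_on \<mu> (cball x r) (2 * \<delta> / (\<delta> - 2)) (P_B \<mu> p (cball x r) f))\<^sup>2
           \<le> 3 * A * r\<^sup>2 / V \<mu> x r powr (2 / \<delta>) *
             (energy_B \<mu> p (cball x r) f + Lp_norm_on \<mu> (cball x r) 2 f ^ 2 / r\<^sup>2)"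
    if r: "r > 0" and f: "f \<in> L2_on \<mu> (cball x r)" for r x f
  proof -
    let ?B = "cball x r"
    \<comment> \<open>Extension by zero identifies \<open>P_B\<close> with \<open>P g\<close>, and
      the energies agree because \<open>g\<close> vanishes off the ball.\<close>
    define g where "g y = indicator ?B y * f y" for y
    define v where "v = V \<mu> x r"
    define N where "N = (\<integral>y. (g y)\<^sup>2 \<partial>\<mu>)"
    define Y where "Y = (r\<^sup>2 * energy g + N) / v"
    define Z where "Z = energy g + N / r\<^sup>2"
    have [measurable]: "f \<in> borel_measurable \<mu>" using f by (simp add: L2_on_def)
    have g [measurable]: "g \<in> borel_measurable \<mu>" unfolding g_def by measurable
    have g_sq: "(g y)\<^sup>2 = indicator ?B y * (f y)\<^sup>2" for y by (simp add: g_def indicator_def)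
    have g2: "integrable \<mu> (\<lambda>y. (g y)\<^sup>2)"
      using f by (simp add: L2_on_def set_integrable_def g_sq)
    have PB: "P_B \<mu> p ?B f y = P g y" for y
      by (simp add: P_B_def P_def g_def set_lebesgue_integral_def mult_ac)
    have energy: "energy_B \<mu> p ?B f = energy g"
      unfolding energy_B_def energy_def set_lebesgue_integral_def PB
      by (intro Bochner_Integration.integral_cong) (auto simp: g_def indicator_def)
    have norm2: "(Lp_norm_on \<mu> ?B 2 f)\<^sup>2 = N"
    proof -
      have "(\<integral>y\<in>?B. \<bar>f y\<bar> powr 2 \<partial>\<mu>) = N"
        by (simp add: N_def set_lebesgue_integral_def g_sq)
      moreover have "N \<ge> 0" by (simp add: N_def)
      ultimately show ?thesis by (simp add: Lp_norm_on_def powr_half_sqrt)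
    qed
    have v: "v > 0" using V_pos[OF r] by (simp add: v_def)
    have Y: "Y \<ge> 0" using nn_integral_\<Gamma>(2)[OF g g2] v by (simp add: Y_def N_def)
    define I where "I = (\<integral>y\<in>?B. \<bar>P g y\<bar> powr (2 * \<kappa>) \<partial>\<mu>)"
    have I0: "I \<ge> 0" by (simp add: I_def set_lebesgue_integral_def)
    \<comment> \<open>The bound on the extended integral carries over to the Bochner integral
      without a separate proof of integrability.\<close>
    have I: "I \<le> 3 * v * (A * Y) powr \<kappa>"
      unfolding I_def set_lebesgue_integral_def
    proof (rule integral_real_bounded)
      show "0 \<le> 3 * v * (A * Y) powr \<kappa>" using v by simp
      have "\<bar>t\<bar> powr (2 * \<kappa>) = t\<^sup>2 powr \<kappa>" for t :: real
        by (simp add: powr_powr[symmetric])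
      hence "(\<integral>\<^sup>+y. ennreal (indicator ?B y *\<^sub>R \<bar>P g y\<bar> powr (2 * \<kappa>)) \<partial>\<mu>)
          = (\<integral>\<^sup>+y\<in>?B. ennreal ((P g y)\<^sup>2 powr \<kappa>) \<partial>\<mu>)"
        by (intro nn_integral_cong) (auto simp: indicator_def)
      also have "\<dots> \<le> ennreal (3 * v * (A * Y) powr \<kappa>)"
        using main[OF g g2 r, of x] by (simp add: \<kappa>_def v_def N_def Y_def)
      finally show "(\<integral>\<^sup>+y. ennreal (indicator ?B y *\<^sub>R \<bar>P g y\<bar> powr (2 * \<kappa>)) \<partial>\<mu>) \<le> \<dots>" .
    qed
    have "(Lp_norm_on \<mu> ?B (2 * \<kappa>) (P_B \<mu> p ?B f))\<^sup>2 = (I powr (1 / (2 * \<kappa>)))\<^sup>2"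
      by (simp add: Lp_norm_on_def PB I_def)
    also have "\<dots> = I powr (1 / \<kappa>)"
      by (simp add: power2_eq_square powr_add[symmetric] field_simps)
    also have "\<dots> \<le> (3 * v * (A * Y) powr \<kappa>) powr (1 / \<kappa>)"
      using I I0 \<kappa> by (intro powr_mono2) auto
    also have "\<dots> = 3 powr (1 / \<kappa>) * v powr (1 / \<kappa>) * (A * Y)"
      using v A Y \<kappa> by (simp add: powr_mult powr_powr)
    also have "\<dots> \<le> 3 * v powr (1 / \<kappa>) * (A * Y)"
    proof -
      have "(3::real) powr (1 / \<kappa>) \<le> 3 powr 1" using \<kappa> by (intro powr_mono) auto
      thus ?thesis using A Y by (intro mult_right_mono) auto
    qed
    \<comment> \<open>The full factor \<open>v\<close> cancels the denominator of \<open>Y\<close>;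
      what remains is the volume factor with exponent \<open>2 / \<delta>\<close>.\<close>
    also have "v powr (1 / \<kappa>) = v * v powr (1 / \<kappa> - 1)"
      using v by (simp add: powr_diff)
    also have "\<dots> = v / v powr (2 / \<delta>)"
      unfolding e by (simp add: powr_minus_divide)
    also have "3 * (v / v powr (2 / \<delta>)) * (A * Y) = 3 * A / v powr (2 / \<delta>) * (r\<^sup>2 * energy g + N)"
      using v by (simp add: Y_def)
    also have "r\<^sup>2 * energy g + N = r\<^sup>2 * Z"
      using r by (simp add: Z_def field_simps)
    finally show ?thesis unfolding q energy norm2 Z_def[symmetric] by (simp add: v_def)
  qed
  moreover have "3 * A > 0" using A by simp
  ultimately show ?thesis using \<delta> by blast
qed

end
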